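(* Let $f:\mathbb{R}^n\to\mathbb{R}^n$ be a smooth vector field, asymptotically quasi-homogeneous at infinity of type $\alpha=(\alpha_1,\dots,\alpha_n)$ and order $k+1$. Let $T$ be a directional compactification of type $\alpha$, determined by $y_j=x_j/s^{\alpha_j}$ $(j\ne i)$, $y_i=\sigma/s^{\alpha_i}$ for a fixed $i\in\{1,\dots,n\}$ and a fixed sign $\sigma\in\{+1,-1\}$, and let $\frac{d(s,x)}{d\tau_d}=g_d(s,x)$ be the associated desingularized vector field on $\{s\ge0\}\times\mathbb{R}^{n-1}$. Let $y_0\in\mathbb{R}^n$ with $\sigma(y_0)_i>0$, and $(s_0,x_0)=T(y_0)$. Assume that the following validation procedure succeeds, i.e. that the following have been validated: 1. an equilibrium at infinity $(0,x_* )$, namely a zero of $g_d$ on $\mathcal{E}=\{s=0\}$; 2. a compact, star-shaped set $\tilde N\subset\{s\ge0\}\times\mathbb{R}^{n-1}$ containing $(0,x_* )$ (taken as large as possible) and a positive definite, real symmetric matrix $Y$ such that $A(s,x):=Dg_d(s,x)^TY+Y\,Dg_d(s,x)$ is strictly negative definite for all $(s,x)\in\tilde N$, where $Dg_d$ is the Jacobian matrix of $g_d$; 3. with $L(s,x)=((s,x)-(0,x_* ))^TY((s,x)-(0,x_* ))$ and $\epsilon>0$ the maximal value such that $N:=\{(s,x)\in\{s\ge0\}\times\mathbb{R}^{n-1}\mid L(s,x)\le\epsilon\}\subset\tilde N$, a time $\tau_N>0$ such that the solution $(s(\tau_d),x(\tau_d))$ of the desingularized system with initial data $(s_0,x_0)\in\{s>0\}\times\mathbb{R}^{n-1}$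 exists on $[0,\tau_N]$ and satisfies $(s(\tau_N),x(\tau_N))\in\mathrm{int}\,N=\{(s,x)\mid s\ge0,\ L(s,x)<\epsilon\}$; 4. finiteness of the quantity $$\overline{C_{n,k,N}}(\epsilon):=\frac{2}{\tilde c_N}\sqrt{\frac{\epsilon^k}{c_1}},$$ together with the value $t_N=\int_0^{\tau_N}s(\tau_d)^k\,d\tau_d$. Then $(0,x_* )\in\mathcal{E}$ is an asymptotically stable equilibrium of the desingularized vector field, the solution $(s(\tau_d),x(\tau_d))$ exists for all $\tau_d\in[0,\infty)$ with $s(\tau_d)\to0$ and $x(\tau_d)\to x_*$ as $\tau_d\to\infty$, and the corresponding solution $y(t)=T^{-1}(s(t),x(t))$ of $y'=f(y)$ with $y(0)=y_0$, obtained via the time-variable desingularization $d\tau_d=s(t)^{-k}dt$, is a blow-up solution with blow-up time $$t_{\max}\in\left[t_N,\ t_N+\overline{C_{n,k,N}}(\epsilon)\right].$$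
   Context: Natural numbers are $\ge1$; $\alpha_1,\dots,\alpha_n$ and $k$ are natural numbers. Quasi-homogeneity: a smooth function $h:\mathbb{R}^n\to\mathbb{R}$ is homogeneous of type $\alpha$ and order $m$ if $h(r^{\alpha_1}x_1,\dots,r^{\alpha_n}x_n)=r^mh(x)$ for all $x\in\mathbb{R}^n$, $r\in\mathbb{R}$. A smooth vector field $(h_1,\dots,h_n)$ is quasi-homogeneous of type $\alpha$ and order $k+1$ if each $h_j$ is homogeneous of type $\alpha$ and order $k+\alpha_j$. A smooth vector field $f=(f_1,\dots,f_n)$ is asymptotically quasi-homogeneous at infinity of type $\alpha$ and order $k+1$ if there is a quasi-homogeneous vector field $f_{\alpha,k}$ of type $\alpha$ and order $k+1$ such that for each $j$, $\lim_{r\to+\infty}r^{-(k+\alpha_j)}\{f_j(r^{\alpha_1}x_1,\dots,r^{\alpha_n}x_n)-r^{k+\alpha_j}(f_{\alpha,k})_j(x)\}=0$ uniformly for $x\in S^{n-1}$. Directional compactification: $T$ maps $\{y\in\mathbb{R}^n\mid\sigma y_i>0\}$ to $\{s>0\}\times\mathbb{R}^{n-1}$, $y\mapsto(s,x)=(s,(x_j)_{j\neq i})$, with $y_j=x_js^{-\alpha_j}$ $(j\neq i)$ and $y_i=\sigma s^{-\alpha_i}$. The set $\mathcal{E}=\{s=0\}$, called the horizon, represents infinity. Desingularized vector field: for $s>0$ put $\hat f_j(s,x)=s^{k+\alpha_j}f_j(T^{-1}(s,x))$, extended continuously to $s=0$. The field $g_d$ is obtained by writing $y'=f(y)$ in the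 variables $(s,x)$ and in the time variable $\tau_d$ given by $d\tau_d=s(t)^{-k}dt$: $$\frac{ds}{d\tau_d}=-\frac{\sigma}{\alpha_i}\,s\,\hat f_i(s,x),\qquad\frac{dx_j}{d\tau_d}=\hat f_j(s,x)-\frac{\sigma\alpha_j}{\alpha_i}\,x_j\,\hat f_i(s,x)\quad(j\neq i).$$ Constants: $c_1,\tilde c_N>0$ are constants involving the eigenvalues of $Y$ and of $A(s,x)$, such that $|s|^2+\|x-x_*\|^2\le c_1L(s,x)$ on $\tilde N$ and $\frac{dL}{d\tau_d}\le-\tilde c_Nc_1L$ along trajectories of the desingularized system in $\tilde N$. Blow-up: a solution of $y'=f(y)$, $y(0)=y_0$, is a blow-up solution if its maximal existence time $t_{\max}=\sup\{\bar t\mid\text{a solution }y\in C^1([0,\bar t))\text{ exists}\}$ is finite; $t_{\max}$ is then called its blow-up time.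
   Formalization: The printed blow-up time bound fails in general for k≥2 (e.g. f=(y_1^3,0), Y=I/100); it is proved when c_1^{k-1}≤k^2 (always for k=1), and in all cases t_max lies in [t_N, t_N+(2/(k c̃_N c_1))·sqrt((c_1 ε)^k)]. *)

theory Defs
  imports "HOL-Analysis.Analysis"
begin

section \<open>Smooth and quasi-homogeneous vector fields\<close>

fun continuously_differentiable_upto ::
    "nat \<Rightarrow> ('a::euclidean_space \<Rightarrow> 'b::real_normed_vector) \<Rightarrow> bool" where
  "continuously_differentiable_upto 0 h \<longleftrightarrow> continuous_on UNIV h"
| "continuously_differentiable_upto (Suc m) h \<longleftrightarrow>
     (\<forall>x. h differentiable (at x)) \<and>
     (\<forall>v. continuously_differentiable_upto m (\<lambda>x. frechet_derivative h (at x) v))"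

definition smooth :: "('a::euclidean_space \<Rightarrow> 'b::real_normed_vector) \<Rightarrow> bool" where
  "smooth h \<longleftrightarrow> (\<forall>m. continuously_differentiable_upto m h)"

definition weighted_scaling :: "('n::finite \<Rightarrow> nat) \<Rightarrow> real \<Rightarrow> real^'n \<Rightarrow> real^'n" where
  "weighted_scaling \<alpha> r x = (\<chi> j. r ^ \<alpha> j * x $ j)"

definition homogeneous :: "('n::finite \<Rightarrow> nat) \<Rightarrow> nat \<Rightarrow> (real^'n \<Rightarrow> real) \<Rightarrow> bool" where
  "homogeneous \<alpha> m h \<longleftrightarrow> smooth h \<and> (\<forall>x r. h (weighted_scaling \<alpha> r x) = r ^ m * h x)"

text \<open>In the next two predicates the order of the vector field is \<open>k + 1\<close>, not \<open>k\<close>.\<close>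

definition quasi_homogeneous :: "('n::finite \<Rightarrow> nat) \<Rightarrow> nat \<Rightarrow> (real^'n \<Rightarrow> real^'n) \<Rightarrow> bool" where
  "quasi_homogeneous \<alpha> k h \<longleftrightarrow> smooth h \<and> (\<forall>j. homogeneous \<alpha> (k + \<alpha> j) (\<lambda>x. h x $ j))"

definition asymptotically_quasi_homogeneous ::
    "('n::finite \<Rightarrow> nat) \<Rightarrow> nat \<Rightarrow> (real^'n \<Rightarrow> real^'n) \<Rightarrow> bool" where
  "asymptotically_quasi_homogeneous \<alpha> k f \<longleftrightarrow> smooth f \<and>
     (\<exists>h. quasi_homogeneous \<alpha> k h \<and>
       (\<forall>j. uniform_limit (sphere 0 1)
          (\<lambda>r x. inverse (r ^ (k + \<alpha> j)) *
                  (f (weighted_scaling \<alpha> r x) $ j - r ^ (k + \<alpha> j) * h x $ j))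
          (\<lambda>x. 0) at_top))"


section \<open>Directional compactification and desingularized vector field\<close>

text \<open>
  A point \<open>(s, x)\<close> with \<open>x = (x\<^sub>j)\<^sub>j\<^sub>\<noteq>\<^sub>i\<close> is encoded as a single vector \<open>z\<close> of
  \<open>real^'n\<close>: \<open>z $ i = s\<close> and \<open>z $ j = x\<^sub>j\<close> for \<open>j \<noteq> i\<close>. The Euclidean norm of \<open>z\<close>
  is that of \<open>(s, x)\<close>.
\<close>

definition phase_space :: "'n::finite \<Rightarrow> (real^'n) set" where
  "phase_space i = {z. 0 \<le> z $ i}"

definition horizon :: "'n::finite \<Rightarrow> (real^'n) set" where
  "horizon i = {z. z $ i = 0}"

definition compactification_inv ::
    "('n::finite \<Rightarrow> nat) \<Rightarrow> 'n \<Rightarrow> real \<Rightarrow> real^'n \<Rightarrow> real^'n" where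
  "compactification_inv \<alpha> i \<sigma> z =
     (\<chi> j. if j = i then \<sigma> / (z $ i) ^ \<alpha> i else z $ j / (z $ i) ^ \<alpha> j)"

definition compactification ::
    "('n::finite \<Rightarrow> nat) \<Rightarrow> 'n \<Rightarrow> real \<Rightarrow> real^'n \<Rightarrow> real^'n" where
  "compactification \<alpha> i \<sigma> = inv_into {z. 0 < z $ i} (compactification_inv \<alpha> i \<sigma>)"

lemma bij_betw_compactification_inv:
  assumes "\<And>j. 1 \<le> \<alpha> j" and "\<sigma> \<in> {1, -1}"
  shows "bij_betw (compactification_inv \<alpha> i \<sigma>) {z. 0 < z $ i} {y. 0 < \<sigma> * y $ i}"
proof (rule bij_betw_byWitness
    [where f' = "\<lambda>y. \<chi> j. if j = i then 1 / root (\<alpha> i) (\<sigma> * y $ i)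
                           else y $ j * (1 / root (\<alpha> i) (\<sigma> * y $ i)) ^ \<alpha> j"])
  have pos: "0 < \<alpha> j" for j using assms(1)[of j] by simp
  have ss: "\<sigma> * \<sigma> = 1" using assms(2) by auto
  have sm: "\<sigma> * (\<sigma> * a) = a" for a :: real
    using ss by (metis mult.assoc mult_1)
  show "\<forall>z\<in>{z. 0 < z $ i}. (\<chi> j. if j = i then 1 / root (\<alpha> i) (\<sigma> * compactification_inv \<alpha> i \<sigma> z $ i)
         else compactification_inv \<alpha> i \<sigma> z $ j *
              (1 / root (\<alpha> i) (\<sigma> * compactification_inv \<alpha> i \<sigma> z $ i)) ^ \<alpha> j) = z"
    using pos ss
    by (auto simp: compactification_inv_def vec_eq_iff real_root_divide real_root_power_cancel
        power_divide)
  show "\<forall>y\<in>{y. 0 < \<sigma> * y $ i}. compactification_inv \<alpha> i \<sigma>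
         (\<chi> j. if j = i then 1 / root (\<alpha> i) (\<sigma> * y $ i)
               else y $ j * (1 / root (\<alpha> i) (\<sigma> * y $ i)) ^ \<alpha> j) = y"
    using pos sm
    by (auto simp: compactification_inv_def vec_eq_iff power_divide)
  show "compactification_inv \<alpha> i \<sigma> ` {z. 0 < z $ i} \<subseteq> {y. 0 < \<sigma> * y $ i}"
    using ss by (auto simp: compactification_inv_def)
  show "(\<lambda>y. \<chi> j. if j = i then 1 / root (\<alpha> i) (\<sigma> * y $ i)
               else y $ j * (1 / root (\<alpha> i) (\<sigma> * y $ i)) ^ \<alpha> j) ` {y. 0 < \<sigma> * y $ i} \<subseteq> {z. 0 < z $ i}"
    using pos by auto
qed

text \<open>The second branch is the continuous extension to \<open>s = 0\<close>.\<close>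

definition f_hat ::
    "(real^'n \<Rightarrow> real^'n) \<Rightarrow> ('n::finite \<Rightarrow> nat) \<Rightarrow> nat \<Rightarrow> 'n \<Rightarrow> real \<Rightarrow> real^'n \<Rightarrow> real^'n" where
  "f_hat f \<alpha> k i \<sigma> z =
     (let F = (\<lambda>w. \<chi> j. (w $ i) ^ (k + \<alpha> j) * f (compactification_inv \<alpha> i \<sigma> w) $ j)
      in if 0 < z $ i then F z else Lim (at z within {w. 0 < w $ i}) F)"

definition desingularized_field ::
    "(real^'n \<Rightarrow> real^'n) \<Rightarrow> ('n::finite \<Rightarrow> nat) \<Rightarrow> nat \<Rightarrow> 'n \<Rightarrow> real \<Rightarrow> real^'n \<Rightarrow> real^'n" where
  "desingularized_field f \<alpha> k i \<sigma> z =
     (\<chi> j. if j = i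
           then - (\<sigma> / real (\<alpha> i)) * z $ i * f_hat f \<alpha> k i \<sigma> z $ i
           else f_hat f \<alpha> k i \<sigma> z $ j
                - \<sigma> * real (\<alpha> j) / real (\<alpha> i) * z $ j * f_hat f \<alpha> k i \<sigma> z $ i)"

text \<open>Inverse of the time change \<open>d\<tau> = s\<^sup>-\<^sup>k dt\<close> along \<open>w\<close>, with \<open>t = 0\<close> at \<open>\<tau> = 0\<close>.\<close>

definition physical_time :: "nat \<Rightarrow> 'n::finite \<Rightarrow> (real \<Rightarrow> real^'n) \<Rightarrow> real \<Rightarrow> real" where
  "physical_time k i w \<tau> = integral {0..\<tau>} (\<lambda>u. (w u $ i) ^ k)"


section \<open>Autonomous differential equations\<close>

text \<open>At an endpoint of the time interval \<open>J\<close> the derivative is one-sided.\<close>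

definition solves ::
    "('a::real_normed_vector \<Rightarrow> 'a) \<Rightarrow> 'a set \<Rightarrow> real set \<Rightarrow> (real \<Rightarrow> 'a) \<Rightarrow> bool" where
  "solves g S J z \<longleftrightarrow> (\<forall>t\<in>J. z t \<in> S \<and> (z has_vector_derivative g (z t)) (at t within J))"

definition asymptotically_stable ::
    "('a::real_normed_vector \<Rightarrow> 'a) \<Rightarrow> 'a set \<Rightarrow> 'a \<Rightarrow> bool" where
  "asymptotically_stable g S p \<longleftrightarrow>
     p \<in> S \<and> g p = 0 \<and>
     (\<forall>e>0. \<exists>d>0. \<forall>z0\<in>S. dist z0 p < d \<longrightarrow>
        (\<exists>z. z 0 = z0 \<and> solves g S {0..} z) \<and>
        (\<forall>z T. z 0 = z0 \<and> solves g S {0..<T} z \<longrightarrow> (\<forall>t\<in>{0..<T}. dist (z t) p < e))) \<and>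
     (\<exists>d>0. \<forall>z0\<in>S. dist z0 p < d \<longrightarrow>
        (\<forall>z. z 0 = z0 \<and> solves g S {0..} z \<longrightarrow> (z \<longlongrightarrow> p) at_top))"

text \<open>For continuous \<open>f\<close> every solution is automatically \<open>C\<^sup>1\<close>.\<close>

definition max_existence_time :: "('a::real_normed_vector \<Rightarrow> 'a) \<Rightarrow> 'a \<Rightarrow> ereal" where
  "max_existence_time f y0 =
     Sup (ereal ` {T. 0 < T \<and> (\<exists>y. y 0 = y0 \<and> solves f UNIV {0..<T} y)})"

text \<open>\<open>tmax\<close> is real, so this includes finiteness of the maximal existence time.\<close>

definition blow_up_solution ::
    "('a::real_normed_vector \<Rightarrow> 'a) \<Rightarrow> 'a \<Rightarrow> (real \<Rightarrow> 'a) \<Rightarrow> real \<Rightarrow> bool" where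
  "blow_up_solution f y0 y tmax \<longleftrightarrow>
     y 0 = y0 \<and> solves f UNIV {0..<tmax} y \<and> max_existence_time f y0 = ereal tmax"


section \<open>Lyapunov functions\<close>

definition positive_definite :: "real^'n^'n \<Rightarrow> bool" where
  "positive_definite M \<longleftrightarrow> transpose M = M \<and> (\<forall>v. v \<noteq> 0 \<longrightarrow> 0 < v \<bullet> (M *v v))"

definition negative_definite :: "real^'n^'n \<Rightarrow> bool" where
  "negative_definite M \<longleftrightarrow> transpose M = M \<and> (\<forall>v. v \<noteq> 0 \<longrightarrow> v \<bullet> (M *v v) < 0)"

definition lyapunov_function :: "real^'n^'n \<Rightarrow> real^'n \<Rightarrow> real^'n \<Rightarrow> real" where
  "lyapunov_function Y p z = (z - p) \<bullet> (Y *v (z - p))"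

text \<open>The Jacobian is taken within \<open>S\<close>, so that it is one-sided on the boundary of \<open>S\<close>.\<close>

definition lyapunov_matrix ::
    "(real^'n \<Rightarrow> real^'n) \<Rightarrow> (real^'n) set \<Rightarrow> real^'n^'n \<Rightarrow> real^'n \<Rightarrow> real^'n^'n" where
  "lyapunov_matrix g S Y z =
     transpose (jacobian g (at z within S)) ** Y + Y ** jacobian g (at z within S)"

definition sublevel :: "'n::finite \<Rightarrow> real^'n^'n \<Rightarrow> real^'n \<Rightarrow> real \<Rightarrow> (real^'n) set" where
  "sublevel i Y p \<epsilon> = {z \<in> phase_space i. lyapunov_function Y p z \<le> \<epsilon>}"

text \<open>The constants \<open>c\<^sub>1\<close> and \<open>c\<close> (for \<open>c\<^sub>N\<close> with a tilde); the second condition is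
  \<open>dL/d\<tau> \<le> - c c\<^sub>1 L\<close> along every trajectory that stays in \<open>N\<close>.\<close>

definition lyapunov_constants ::
    "(real^'n \<Rightarrow> real^'n) \<Rightarrow> (real^'n) set \<Rightarrow> real^'n^'n \<Rightarrow> real^'n \<Rightarrow> real \<Rightarrow> real \<Rightarrow> bool" where
  "lyapunov_constants g N Y p c1 c \<longleftrightarrow> 0 < c1 \<and> 0 < c \<and>
     (\<forall>z\<in>N. (norm (z - p))\<^sup>2 \<le> c1 * lyapunov_function Y p z) \<and>
     (\<forall>a b z. a < b \<and> solves g N {a..b} z \<longrightarrow>
        (\<forall>\<tau>\<in>{a..b}.
           vector_derivative (\<lambda>t. lyapunov_function Y p (z t)) (at \<tau> within {a..b})
             \<le> - c * c1 * lyapunov_function Y p (z \<tau>)))"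

definition blow_up_time_bound :: "nat \<Rightarrow> real \<Rightarrow> real \<Rightarrow> real \<Rightarrow> real" where
  "blow_up_time_bound k c1 c \<epsilon> = 2 / c * sqrt (\<epsilon> ^ k / c1)"

text \<open>
  The integral of \<open>(c\<^sub>1 L)\<^bsup>k/2\<^esup>\<close> over \<open>\<tau> \<ge> 0\<close> for
  \<open>L = \<epsilon> exp (- c c\<^sub>1 \<tau>)\<close>. It is the bound that the estimates
  \<open>s\<^sup>2 \<le> c\<^sub>1 L\<close> and \<open>dL/d\<tau> \<le> - c c\<^sub>1 L\<close> give. It equals \<open>blow_up_time_bound\<close>
  when \<open>k = 1\<close>, and is at most that iff \<open>c\<^sub>1\<^bsup>k-1\<^esup> \<le> k\<^sup>2\<close>.
  For \<open>k \<ge> 2\<close> and large \<open>c\<^sub>1\<close> the remaining time can exceed \<open>blow_up_time_bound\<close>: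
  for \<open>f y = (y\<^sub>1\<^sup>3, 0)\<close>, all weights \<open>1\<close>, \<open>k = 2\<close> and \<open>\<sigma> = 1\<close> the desingularized
  field is \<open>z \<mapsto> -z\<close>; take \<open>Y = (1/100) I\<close>, \<open>c\<^sub>1 = 100\<close>, \<open>c = 1/50\<close>,
  the half disc of radius 2 (so \<open>\<epsilon> = 1/25\<close>) and \<open>y\<^sub>0 = (1, 0)\<close>. The blow-up time is
  \<open>1/2\<close>, \<open>blow_up_time_bound\<close> is \<open>2/5\<close>, and the time at entry can be taken below \<open>1/10\<close>.
\<close>

definition integrated_time_bound :: "nat \<Rightarrow> real \<Rightarrow> real \<Rightarrow> real \<Rightarrow> real" where
  "integrated_time_bound k c1 c \<epsilon> = 2 / (real k * c * c1) * sqrt ((c1 * \<epsilon>) ^ k)"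

end

theory Submission
  imports Defs
begin

text \<open>
  On the convex sublevel set \<open>N\<close> negative definiteness of \<open>A\<close> makes the desingularized field
  \<open>g\<close> strictly dissipative in the \<open>Y\<close>-inner product (differentiate along segments).
  So \<open>L\<close> decreases along trajectories, solutions in \<open>N\<close> are unique, and compactness of
  \<open>{L \<ge> r} \<inter> N\<close> forces them to converge to the equilibrium. The Jacobian of \<open>g\<close> need not be
  continuous up to the horizon, so existence is not obtained for \<open>g\<close> on \<open>N\<close> as a whole:
  \<open>g\<close> is Lipschitz on compact sets with \<open>s\<close> bounded away from \<open>0\<close>, and on compact subsets
  of the horizon, where it is given by the quasi-homogeneous part of \<open>f\<close>. On such a convex set the
  field composed with the nearest-point projection has a global solution, and that solution does not
  leave the set, because \<open>L\<close> decreases and \<open>s\<close> decays at most exponentially.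
  Differentiability at the equilibrium itself gives exponential decay of \<open>L\<close>, hence of \<open>s\<close>, so
  \<open>\<integral> s\<^sup>k d\<tau>\<close> converges, and its value is the blow-up time: a solution of \<open>y' = f y\<close> living longer
  would satisfy \<open>y\<^sub>i s\<^sup>\<alpha> = \<sigma>\<close> with bounded \<open>y\<^sub>i\<close> and \<open>s\<close> tending to \<open>0\<close>.
\<close>

section \<open>Scalar differential inequalities and global solutions\<close>

lemma DERIV_nonpos_imp_decreasing_within:
  fixes v v' :: "real \<Rightarrow> real"
  assumes "a \<le> b"
    and der: "\<And>t. t \<in> {a..b} \<Longrightarrow> (v has_real_derivative v' t) (at t within {a..b})"
    and le: "\<And>t. t \<in> {a..b} \<Longrightarrow> v' t \<le> 0"
  shows "v b \<le> v a"
proof (rule DERIV_nonpos_imp_decreasing_open[OF \<open>a \<le> b\<close>])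
  show "\<exists>y. DERIV v x :> y \<and> y \<le> 0" if "a < x" "x < b" for x
    using der[of x] le[of x] that by (auto simp: at_within_Icc_at)
  show "continuous_on {a..b} v"
    using der by (meson DERIV_continuous_on)
qed

text \<open>The product of \<open>v\<close> with the integrating factor
  \<open>exp (- c * (t - a))\<close> is nonincreasing. Neither \<open>c\<close> nor \<open>v\<close>
  has a prescribed sign, so lower bounds follow by applying the estimate to a negated
  function.\<close>

lemma gronwall:
  fixes v v' :: "real \<Rightarrow> real"
  assumes "a \<le> b"
    and der: "\<And>t. t \<in> {a..b} \<Longrightarrow> (v has_real_derivative v' t) (at t within {a..b})"
    and le: "\<And>t. t \<in> {a..b} \<Longrightarrow> v' t \<le> c * v t"
  shows "v b \<le> v a * exp (c * (b - a))"
proof -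
  let ?q = "\<lambda>t. v t * exp (- c * (t - a))"
  have "?q b \<le> ?q a"
  proof (rule DERIV_nonpos_imp_decreasing_within[OF \<open>a \<le> b\<close>])
    fix t assume t: "t \<in> {a..b}"
    show "(?q has_real_derivative (v' t - c * v t) * exp (- c * (t - a))) (at t within {a..b})"
      by (rule derivative_eq_intros der[OF t] refl | simp add: algebra_simps)+
    show "(v' t - c * v t) * exp (- c * (t - a)) \<le> 0"
      using le[OF t] by (simp add: mult_nonpos_nonneg)
  qed
  then have "v b * exp (- c * (b - a)) * exp (c * (b - a)) \<le> v a * exp (c * (b - a))"
    by (intro mult_right_mono) auto
  then show ?thesis by (simp add: mult.assoc flip: exp_add)
qed

text \<open>Continuous induction on the infimum of the bad times: closedness of \<open>C\<close>
  makes that time good, and \<open>step\<close> then keeps the path in \<open>C\<close> a little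
  longer, contradicting the infimum. In \<open>step\<close> the whole past may be assumed to lie in
  \<open>C\<close>, so estimates valid only inside \<open>C\<close> are available there.\<close>

lemma barrier:
  fixes u :: "real \<Rightarrow> 'a::topological_space"
  assumes "closed C" and cont: "continuous_on {0..T} u" and "u 0 \<in> C"
    and step: "\<And>t. 0 \<le> t \<Longrightarrow> t < T \<Longrightarrow> u ` {0..t} \<subseteq> C
      \<Longrightarrow> eventually (\<lambda>s. u s \<in> C) (at t within {0..T})"
    and t: "t \<in> {0..T}"
  shows "u t \<in> C"
proof (rule ccontr)
  assume nt: "u t \<notin> C"
  define E where "E = {s\<in>{0..T}. u s \<notin> C}"
  have tE: "t \<in> E" using nt t by (simp add: E_def)
  have bdd: "bdd_below E" by (auto simp: E_def bdd_below_def)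
  define m where "m = Inf E"
  have m: "0 \<le> m" "m \<le> t"
    unfolding m_def using tE by (auto simp: E_def intro!: cInf_greatest cInf_lower bdd[unfolded E_def])
  have lt: "u s \<in> C" if "0 \<le> s" "s < m" for s
  proof (rule ccontr)
    assume "u s \<notin> C"
    then have "s \<in> E" using that m t by (auto simp: E_def)
    then show False using cInf_lower[OF _ bdd] that m_def by fastforce
  qed
  \<comment> \<open>For \<open>m > 0\<close> the value at \<open>m\<close> is a limit of points of
    \<open>C\<close> from the left; for \<open>m = 0\<close> it is the initial value.\<close>
  have um: "u m \<in> C"
  proof (cases "m = 0")
    case True then show ?thesis using \<open>u 0 \<in> C\<close> by simp
  next
    case False
    have "(u \<longlongrightarrow> u m) (at m within {0..<m})"
      using cont m t by (auto simp: continuous_on_def intro: tendsto_within_subset[of _ _ _ "{0..T}"])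
    moreover have "at m within {0..<m} \<noteq> bot"
      using False m by (simp add: at_within_eq_bot_iff closure_atLeastLessThan)
    moreover have "eventually (\<lambda>s. u s \<in> C) (at m within {0..<m})"
      using lt by (auto simp: eventually_at_filter)
    ultimately show ?thesis using Lim_in_closed_set[OF \<open>closed C\<close>] by blast
  qed
  have mT: "m < T"
    using um nt m t by (cases "m = t") auto
  have "u ` {0..m} \<subseteq> C" using lt um by (auto simp: less_eq_real_def)
  from step[OF m(1) mT this] obtain d where d: "d > 0"
    "\<And>s. s \<in> {0..T} \<Longrightarrow> s \<noteq> m \<Longrightarrow> dist s m < d \<Longrightarrow> u s \<in> C"
    unfolding eventually_at by blast
  have "m + d \<le> s" if "s \<in> E" for s
  proof -
    have "m \<le> s" using cInf_lower[OF that bdd] m_def by simp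
    moreover have "s \<noteq> m" "s \<in> {0..T}" "u s \<notin> C" using that um by (auto simp: E_def)
    ultimately show ?thesis using d(2)[of s] by (force simp: dist_real_def)
  qed
  then have "m + d \<le> m" unfolding m_def using tE by (intro cInf_greatest) auto
  with d show False by simp
qed

lemma at_within_Ici_eq_Icc:
  fixes t :: real
  assumes "a \<le> t" "t < b"
  shows "at t within {a..} = at t within {a..b}"
  by (rule at_within_nhd[where S = "{..<b}"]) (use assms in auto)

text \<open>Contraction argument in the weighted norm \<open>sup exp (- l t) norm (u t)\<close>, which gives a
  solution on the whole half-line in one step.\<close>

lemma picard_global:
  fixes G :: "'a::banach \<Rightarrow> 'a"
  assumes lip: "L-lipschitz_on UNIV G" and bdd: "\<And>x. norm (G x) \<le> B"
  obtains u where "u 0 = x0"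
    "\<And>t. 0 \<le> t \<Longrightarrow> (u has_vector_derivative G (u t)) (at t within {0..})"
proof -
  \<comment> \<open>The Picard operator contracts by \<open>L / l\<close> in the weighted norm; the
    summand 1 keeps \<open>l\<close> positive when \<open>L = 0\<close>.\<close>
  define l where "l = 2 * L + 1"
  have L: "0 \<le> L" using lip lipschitz_on_nonneg by blast
  have l: "0 < l" "L / l < 1" using L by (auto simp: l_def field_simps)
  have B: "0 \<le> B" using bdd[of x0] norm_ge_zero order_trans by blast
  have contG: "continuous_on UNIV G" using lip by (rule lipschitz_on_continuous_on)
  define K where "K \<psi> = (\<lambda>u. G (exp (l * u) *\<^sub>R apply_bcontfun \<psi> u))" for \<psi> :: "real \<Rightarrow>\<^sub>C 'a"
  define J where "J \<psi> t = x0 + integral {0..t} (K \<psi>)" for \<psi> :: "real \<Rightarrow>\<^sub>C 'a" and t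
  have contK: "continuous_on S (K \<psi>)" for \<psi> S
    unfolding K_def by (intro continuous_on_compose2[OF contG] continuous_intros) auto
  have intK: "K \<psi> integrable_on {0..t}" for \<psi> t
    by (intro integrable_continuous_interval contK)
  have derJ: "(J \<psi> has_vector_derivative K \<psi> t) (at t within {0..})" if "0 \<le> t" for \<psi> t
    unfolding J_def at_within_Ici_eq_Icc[OF that less_add_one]
    using integral_has_vector_derivative[OF contK, of t 0 "t + 1"] that
    by (auto intro!: derivative_eq_intros)
  have contJ: "continuous_on {0..} (J \<psi>)" for \<psi>
    using derJ by (meson atLeast_iff continuous_on_eq_continuous_within has_vector_derivative_continuous)
  \<comment> \<open>This is the Picard operator for the rescaled unknown
    \<open>exp (- l * t) *\<^sub>R u t\<close>. Replacing \<open>t\<close> by \<open>max 0 t\<close>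
    makes it constant for negative times, so that it acts on bounded continuous functions on the
    whole line.\<close>
  define Q where "Q \<psi> t = exp (- l * max 0 t) *\<^sub>R J \<psi> (max 0 t)" for \<psi> t
  have "Q \<psi> \<in> bcontfun" for \<psi>
  proof (rule bcontfun_normI)
    show "continuous_on UNIV (Q \<psi>)"
      unfolding Q_def by (intro continuous_intros continuous_on_compose2[OF contJ]) auto
    show "norm (Q \<psi> t) \<le> norm x0 + B / l" for t
    proof -
      define r where "r = max 0 t"
      have r: "0 \<le> r" by (simp add: r_def)
      have "norm (integral {0..r} (K \<psi>)) \<le> integral {0..r} (\<lambda>u. B)"
        by (intro integral_norm_bound_integral intK) (auto simp: K_def bdd)
      then have J: "norm (J \<psi> r) \<le> norm x0 + B * r"
        unfolding J_def using r norm_triangle_ineq[of x0 "integral {0..r} (K \<psi>)"]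
        by (simp add: mult.commute)
      \<comment> \<open>Boundedness of \<open>G\<close> gives at most linear growth of the integral,
        which the exponential weight absorbs.\<close>
      have "l * r \<le> exp (l * r)" using exp_ge_add_one_self[of "l * r"] by linarith
      then have "B * r \<le> B / l * exp (l * r)"
        using mult_left_mono[OF _ B] l by (fastforce simp: field_simps)
      moreover have "norm x0 \<le> norm x0 * exp (l * r)" 
        using mult_left_mono[of 1 "exp (l * r)" "norm x0"] l r by simp
      ultimately have "norm (J \<psi> r) \<le> (norm x0 + B / l) * exp (l * r)"
        using J by (simp add: algebra_simps)
      then show ?thesis unfolding Q_def r_def[symmetric]
        by (simp add: exp_minus field_simps)
    qed
  qed
  then have app: "apply_bcontfun (Bcontfun (Q \<psi>)) = Q \<psi>" for \<psi>
    by (simp add: Bcontfun_inverse)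
  have "\<exists>!\<psi>. Bcontfun (Q \<psi>) = \<psi>"
  proof (rule banach_fix_type[of "L / l"], use L l in simp, use l in simp, intro allI dist_bound)
    fix \<psi> \<phi> :: "real \<Rightarrow>\<^sub>C 'a" and t :: real
    define r where "r = max 0 t"
    have r: "0 \<le> r" by (simp add: r_def)
    have "((\<lambda>u. L * dist \<psi> \<phi> * exp (l * u)) has_integral
        L * dist \<psi> \<phi> * exp (l * r) / l - L * dist \<psi> \<phi> * exp (l * 0) / l) {0..r}"
      using r l by (intro fundamental_theorem_of_calculus)
        (auto intro!: derivative_eq_intros simp: has_real_derivative_iff_has_vector_derivative[symmetric])
    note int = has_integral_integrable[OF this] integral_unique[OF this]
    have "J \<psi> r - J \<phi> r = integral {0..r} (\<lambda>u. K \<psi> u - K \<phi> u)"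
      unfolding J_def by (simp add: integral_diff intK)
    also have "norm \<dots> \<le> integral {0..r} (\<lambda>u. L * dist \<psi> \<phi> * exp (l * u))"
    proof (intro integral_norm_bound_integral integrable_diff intK int(1))
      fix u
      have "norm (K \<psi> u - K \<phi> u) \<le> L * dist (exp (l * u) *\<^sub>R apply_bcontfun \<psi> u) (exp (l * u) *\<^sub>R apply_bcontfun \<phi> u)"
        unfolding K_def using lipschitz_onD[OF lip] by (auto simp: dist_norm)
      also have "\<dots> = L * (exp (l * u) * dist (apply_bcontfun \<psi> u) (apply_bcontfun \<phi> u))"
        by (simp add: dist_norm flip: scaleR_diff_right)
      also have "\<dots> \<le> L * (exp (l * u) * dist \<psi> \<phi>)"
        using L by (intro mult_left_mono dist_bounded) auto
      finally show "norm (K \<psi> u - K \<phi> u) \<le> L * dist \<psi> \<phi> * exp (l * u)" by (simp add: ac_simps)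
    qed
    also have "\<dots> \<le> L * dist \<psi> \<phi> * exp (l * r) / l"
      unfolding int(2) using L l by simp
    finally have "dist (J \<psi> r) (J \<phi> r) \<le> L * dist \<psi> \<phi> * exp (l * r) / l" by (simp add: dist_norm)
    then have "exp (- l * r) * dist (J \<psi> r) (J \<phi> r) \<le> L / l * dist \<psi> \<phi>"
      by (simp add: exp_minus field_simps)
    then show "dist (apply_bcontfun (Bcontfun (Q \<psi>)) t) (apply_bcontfun (Bcontfun (Q \<phi>)) t) \<le> L / l * dist \<psi> \<phi>"
      unfolding app unfolding Q_def r_def[symmetric]
      by (simp add: dist_norm flip: scaleR_diff_right)
  qed
  then obtain \<psi> where "Bcontfun (Q \<psi>) = \<psi>" by blast
  then have fp: "Q \<psi> = apply_bcontfun \<psi>" using app by metis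
  have J: "J \<psi> t = exp (l * t) *\<^sub>R apply_bcontfun \<psi> t" if "0 \<le> t" for t
    using that unfolding fp[symmetric] Q_def by (simp add: exp_minus)
  show ?thesis
  proof
    show "J \<psi> 0 = x0" by (simp add: J_def)
    show "(J \<psi> has_vector_derivative G (J \<psi> t)) (at t within {0..})" if "0 \<le> t" for t
      using derJ[OF that, of \<psi>] J[OF that] by (simp add: K_def)
  qed
qed

section \<open>Lipschitz functions on compact sets\<close>

lemma lipschitz_on_mult_bounded:
  fixes f g :: "'a::metric_space \<Rightarrow> real"
  assumes f: "A-lipschitz_on K f" and g: "B-lipschitz_on K g"
    and bf: "\<And>x. x \<in> K \<Longrightarrow> \<bar>f x\<bar> \<le> a" and bg: "\<And>x. x \<in> K \<Longrightarrow> \<bar>g x\<bar> \<le> b" and "0 \<le> a" "0 \<le> b"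
  shows "(a * B + b * A)-lipschitz_on K (\<lambda>x. f x * g x)"
proof (rule lipschitz_onI)
  have AB: "0 \<le> A" "0 \<le> B" using f g lipschitz_on_nonneg by blast+
  then show "0 \<le> a * B + b * A" using assms by simp
  fix x y assume K: "x \<in> K" "y \<in> K"
  have "f x * g x - f y * g y = f x * (g x - g y) + g y * (f x - f y)" by (simp add: algebra_simps)
  then have "\<bar>f x * g x - f y * g y\<bar> \<le> \<bar>f x\<bar> * \<bar>g x - g y\<bar> + \<bar>g y\<bar> * \<bar>f x - f y\<bar>"
    using abs_triangle_ineq[of "f x * (g x - g y)" "g y * (f x - f y)"] by (simp add: abs_mult)
  also have "\<dots> \<le> a * (B * dist x y) + b * (A * dist x y)"
    using lipschitz_onD[OF f K] lipschitz_onD[OF g K] bf K bg assms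
    by (intro add_mono mult_mono) (auto simp: dist_real_def)
  finally show "dist (f x * g x) (f y * g y) \<le> (a * B + b * A) * dist x y"
    by (simp add: dist_real_def algebra_simps)
qed

text \<open>Hiding the constant lets the closure rules be chained; later arguments use only its
  existence.\<close>

definition lipschitzian_on :: "'a::metric_space set \<Rightarrow> ('a \<Rightarrow> 'b::metric_space) \<Rightarrow> bool" where
  "lipschitzian_on K f \<longleftrightarrow> (\<exists>L. L-lipschitz_on K f)"

lemma lipschitzian_on_continuous: "lipschitzian_on K f \<Longrightarrow> continuous_on K f"
  by (auto simp: lipschitzian_on_def intro: lipschitz_on_continuous_on)

lemma lipschitzian_on_const: "lipschitzian_on K (\<lambda>x. c)"
  unfolding lipschitzian_on_def using lipschitz_on_constant by blast

lemma lipschitzian_on_minus: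
  fixes f g :: "'a::metric_space \<Rightarrow> 'b::real_normed_vector"
  shows "lipschitzian_on K f \<Longrightarrow> lipschitzian_on K g \<Longrightarrow> lipschitzian_on K (\<lambda>x. f x - g x)"
  unfolding lipschitzian_on_def using lipschitz_on_diff by blast

lemma lipschitzian_on_mult:
  fixes f g :: "'a::metric_space \<Rightarrow> real"
  assumes "compact K" "lipschitzian_on K f" "lipschitzian_on K g"
  shows "lipschitzian_on K (\<lambda>x. f x * g x)"
proof -
  have "\<exists>b\<ge>0. \<forall>x\<in>K. \<bar>h x\<bar> \<le> b" if "lipschitzian_on K h" for h :: "'a \<Rightarrow> real"
  proof -
    have "compact (h ` K)" using that assms(1) lipschitzian_on_continuous compact_continuous_image by blast
    then obtain b where "\<forall>y\<in>h ` K. norm y \<le> b" using compact_imp_bounded bounded_iff by blast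
    then show ?thesis by (intro exI[of _ "max b 0"]) auto
  qed
  from this[OF assms(2)] this[OF assms(3)] obtain a b
    where ab: "0 \<le> a" "\<And>x. x \<in> K \<Longrightarrow> \<bar>f x\<bar> \<le> a" "0 \<le> b" "\<And>x. x \<in> K \<Longrightarrow> \<bar>g x\<bar> \<le> b" by blast
  obtain A B where "A-lipschitz_on K f" "B-lipschitz_on K g"
    using assms(2,3) unfolding lipschitzian_on_def by blast
  from lipschitz_on_mult_bounded[OF this ab(2,4,1,3)] show ?thesis
    unfolding lipschitzian_on_def by blast
qed

lemma lipschitzian_on_power:
  fixes f :: "'a::metric_space \<Rightarrow> real"
  assumes "compact K" "lipschitzian_on K f"
  shows "lipschitzian_on K (\<lambda>x. f x ^ n)"
  by (induction n) (auto intro: lipschitzian_on_const lipschitzian_on_mult assms)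

lemma lipschitzian_on_compose:
  assumes "lipschitzian_on K f" "lipschitzian_on D g" "f ` K \<subseteq> D"
  shows "lipschitzian_on K (\<lambda>x. g (f x))"
proof -
  obtain A B where f: "A-lipschitz_on K f" and g: "B-lipschitz_on D g"
    using assms unfolding lipschitzian_on_def by blast
  have "B-lipschitz_on (f ` K) g" using g assms(3) by (rule lipschitz_on_subset)
  from lipschitz_on_compose2[OF f this] show ?thesis unfolding lipschitzian_on_def by blast
qed

text \<open>The lower bound \<open>a\<close> keeps the values of \<open>f\<close> away from the
  singularity of the reciprocal; it becomes the distance to the horizon later on.\<close>

lemma lipschitzian_on_inverse:
  fixes f :: "'a::metric_space \<Rightarrow> real"
  assumes "lipschitzian_on K f" "0 < a" "\<And>x. x \<in> K \<Longrightarrow> a \<le> f x"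
  shows "lipschitzian_on K (\<lambda>x. inverse (f x))"
proof -
  have "(1 / a\<^sup>2)-lipschitz_on {a..} (inverse :: real \<Rightarrow> real)"
  proof (rule lipschitz_onI)
    fix x y :: real assume xy: "x \<in> {a..}" "y \<in> {a..}"
    have "\<bar>inverse x - inverse y\<bar> = \<bar>x - y\<bar> / (x * y)"
      using xy \<open>0 < a\<close> by (simp add: divide_simps abs_minus_commute abs_mult)
    also have "\<dots> \<le> \<bar>x - y\<bar> / (a * a)"
      using xy \<open>0 < a\<close> by (intro divide_left_mono mult_mono mult_pos_pos) auto
    finally show "dist (inverse x) (inverse y) \<le> 1 / a\<^sup>2 * dist x y"
      by (simp add: dist_real_def power2_eq_square)
  qed simp
  then show ?thesis
    by (intro lipschitzian_on_compose[OF assms(1), of "{a..}"])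
      (use assms(3) in \<open>auto simp: lipschitzian_on_def\<close>)
qed

lemma lipschitzian_on_vec_nth:
  fixes f :: "'a::metric_space \<Rightarrow> real^'n"
  assumes "lipschitzian_on K f" shows "lipschitzian_on K (\<lambda>x. f x $ j)"
  using assms unfolding lipschitzian_on_def
  by (meson dist_vec_nth_le lipschitz_onD lipschitz_onI lipschitz_on_nonneg order_trans)

lemma lipschitzian_on_vec:
  fixes f :: "'a::metric_space \<Rightarrow> real^'n"
  assumes "\<And>j. lipschitzian_on K (\<lambda>x. f x $ j)"
  shows "lipschitzian_on K f"
proof -
  from assms obtain L where L: "\<And>j. (L j)-lipschitz_on K (\<lambda>x. f x $ j)"
    unfolding lipschitzian_on_def by metis
  have "(\<Sum>j\<in>UNIV. L j)-lipschitz_on K f"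
  proof (rule lipschitz_onI)
    fix x y assume K: "x \<in> K" "y \<in> K"
    have "dist (f x) (f y) \<le> (\<Sum>j\<in>UNIV. \<bar>(f x - f y) $ j\<bar>)"
      unfolding dist_norm by (rule norm_le_l1_cart)
    also have "\<dots> \<le> (\<Sum>j\<in>UNIV. L j * dist x y)"
      using lipschitz_onD[OF L K] by (intro sum_mono) (auto simp: dist_real_def)
    finally show "dist (f x) (f y) \<le> (\<Sum>j\<in>UNIV. L j) * dist x y" by (simp add: sum_distrib_right)
  qed (use L lipschitz_on_nonneg in \<open>blast intro: sum_nonneg\<close>)
  then show ?thesis unfolding lipschitzian_on_def by blast
qed

lemma smooth_imp_differentiable: "smooth h \<Longrightarrow> h differentiable (at x)"
  unfolding smooth_def using continuously_differentiable_upto.simps(2)[of 0 h] by blast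

lemma smooth_imp_continuous_on:
  assumes "smooth h" shows "continuous_on S h"
  using smooth_imp_differentiable[OF assms]
  by (meson continuous_at_imp_continuous_on differentiable_imp_continuous_within)

text \<open>Mean value inequality on a convex set. Smoothness provides continuity of
  \<open>frechet_derivative h (at x) v\<close> in \<open>x\<close> for each fixed direction
  \<open>v\<close>, so the operator norm is bounded by summing the bounds over the basis
  directions.\<close>

lemma smooth_imp_lipschitzian_on:
  assumes h: "smooth h" and K: "compact K" "convex K"
  shows "lipschitzian_on K h"
proof -
  let ?D = "\<lambda>x. frechet_derivative h (at x)"
  have "\<exists>B\<ge>0. \<forall>x\<in>K. norm (?D x b) \<le> B" for b
  proof -
    have "continuously_differentiable_upto (Suc 0) h" using h by (simp only: smooth_def)
    then have "continuous_on UNIV (\<lambda>x. ?D x b)" by simp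
    then have "compact ((\<lambda>x. ?D x b) ` K)"
      using K continuous_on_subset compact_continuous_image by blast
    then obtain B where "\<forall>y\<in>(\<lambda>x. ?D x b) ` K. norm y \<le> B" using compact_imp_bounded bounded_iff by blast
    then show ?thesis by (intro exI[of _ "max B 0"]) auto
  qed
  then obtain B where B: "\<And>b. 0 \<le> B b" "\<And>b x. x \<in> K \<Longrightarrow> norm (?D x b) \<le> B b" by metis
  have der: "(h has_derivative ?D x) (at x)" for x
    using smooth_imp_differentiable[OF h] frechet_derivative_works by blast
  have "onorm (?D x) \<le> (\<Sum>b\<in>Basis. B b)" if "x \<in> K" for x
  proof (rule onorm_le)
    fix v
    have lin: "linear (?D x)" using der has_derivative_linear by blast
    have "norm (?D x v) = norm (\<Sum>b\<in>Basis. (v \<bullet> b) *\<^sub>R ?D x b)"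
      using linear_sum[OF lin] linear_cmul[OF lin] euclidean_representation[of v]
      by (metis (mono_tags, lifting) sum.cong)
    also have "\<dots> \<le> (\<Sum>b\<in>Basis. norm v * B b)"
      using B that by (intro order_trans[OF norm_sum] sum_mono)
        (auto intro!: mult_mono Basis_le_norm)
    finally show "norm (?D x v) \<le> (\<Sum>b\<in>Basis. B b) * norm v"
      by (simp add: sum_distrib_left mult.commute)
  qed
  then have "norm (h x - h y) \<le> (\<Sum>b\<in>Basis. B b) * norm (x - y)" if "x \<in> K" "y \<in> K" for x y
    using that der has_derivative_at_withinI
    by (intro differentiable_bound[OF K(2), of h ?D]) blast+
  then have "(\<Sum>b\<in>Basis. B b)-lipschitz_on K h"
    using B(1) by (intro lipschitz_onI) (auto simp: dist_norm sum_nonneg)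
  then show ?thesis unfolding lipschitzian_on_def by blast
qed

lemma lipschitzian_on_id: "lipschitzian_on K (\<lambda>x. x)"
  unfolding lipschitzian_on_def using lipschitz_on_id by blast

lemma lipschitzian_on_nth: "lipschitzian_on K (\<lambda>x :: real^'n. x $ j)"
  by (rule lipschitzian_on_vec_nth[OF lipschitzian_on_id])

lemma lipschitzian_on_cong:
  "lipschitzian_on K f \<Longrightarrow> (\<And>x. x \<in> K \<Longrightarrow> f x = g x) \<Longrightarrow> lipschitzian_on K g"
  unfolding lipschitzian_on_def lipschitz_on_def by auto

lemma lipschitzian_on_smooth_compose:
  assumes "smooth h" "compact K" "lipschitzian_on K u"
  shows "lipschitzian_on K (\<lambda>x. h (u x))"
proof -
  have "compact (u ` K)" using assms lipschitzian_on_continuous compact_continuous_image by blast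
  then obtain R where "\<forall>x\<in>u ` K. norm x \<le> R" using compact_imp_bounded bounded_iff by blast
  then have "u ` K \<subseteq> cball 0 R" by auto
  then show ?thesis
    using lipschitzian_on_compose[OF assms(3) smooth_imp_lipschitzian_on[OF assms(1) compact_cball convex_cball]] by blast
qed

section \<open>Solutions of autonomous equations\<close>

lemma solves_subset: "solves g S J u \<Longrightarrow> J' \<subseteq> J \<Longrightarrow> S \<subseteq> S' \<Longrightarrow> solves g S' J' u"
  unfolding solves_def by (meson has_vector_derivative_within_subset subset_iff)

lemma solves_continuous_on: "solves g S J u \<Longrightarrow> continuous_on J u"
  unfolding solves_def
  by (meson continuous_on_eq_continuous_within has_vector_derivative_continuous)

lemma solves_Ici_iff:
  "solves g S {a..} u \<longleftrightarrow> (\<forall>b. solves g S {a..b} u)" for u :: "real \<Rightarrow> 'a::real_normed_vector"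
proof
  assume *: "\<forall>b. solves g S {a..b} u"
  show "solves g S {a..} u"
    unfolding solves_def
  proof (intro ballI conjI)
    fix t assume t: "t \<in> {a..}"
    then have "t \<in> {a..t + 1}" by simp
    with * show "u t \<in> S" "(u has_vector_derivative g (u t)) (at t within {a..})"
      using t at_within_Ici_eq_Icc[of a t "t + 1"] unfolding solves_def by (auto simp del: atLeastAtMost_iff)
  qed
qed (auto intro: solves_subset)

text \<open>Projection to the nearest point of a convex set is 1-Lipschitz and lands in
  \<open>C\<close>, so the composed field is bounded and Lipschitz on the whole space. While
  \<open>u\<close> remains in \<open>C\<close> it solves the original equation.\<close>

lemma truncated_ode_solution:
  fixes g :: "'a::euclidean_space \<Rightarrow> 'a"
  assumes C: "compact C" "convex C" "x0 \<in> C" and g: "lipschitzian_on C g"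
  obtains u where "u 0 = x0"
    "\<And>t. 0 \<le> t \<Longrightarrow> (u has_vector_derivative g (closest_point C (u t))) (at t within {0..})"
proof -
  have cp: "closest_point C x \<in> C" for x
    using C by (intro closest_point_in_set) (auto dest: compact_imp_closed)
  have "lipschitzian_on UNIV (closest_point C)"
    unfolding lipschitzian_on_def
    using closest_point_lipschitz[of C] C
    by (intro exI[of _ 1] lipschitz_onI) (auto dest: compact_imp_closed)
  from lipschitzian_on_compose[OF this g] obtain K where "K-lipschitz_on UNIV (\<lambda>x. g (closest_point C x))"
    using cp unfolding lipschitzian_on_def by blast
  moreover have "compact (g ` C)"
    using g C(1) lipschitzian_on_continuous compact_continuous_image by blast
  then obtain B where "\<forall>y\<in>g ` C. norm y \<le> B" using compact_imp_bounded bounded_iff by blast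
  then have "norm (g (closest_point C x)) \<le> B" for x using cp by blast
  ultimately show ?thesis using picard_global that by metis
qed

section \<open>Lyapunov sublevel sets\<close>

text \<open>The minimum over the unit sphere is positive, and both sides scale quadratically. The
  matrix is not assumed symmetric: besides \<open>Y\<close>, the negative of \<open>Y\<close> times
  a Jacobian is inserted.\<close>

lemma quadratic_form_lower_bound:
  fixes M :: "real^'n^'n"
  assumes "\<And>v. v \<noteq> 0 \<Longrightarrow> 0 < v \<bullet> (M *v v)"
  obtains m where "0 < m" "\<And>v. m * (norm v)\<^sup>2 \<le> v \<bullet> (M *v v)"
proof -
  have "continuous_on (sphere 0 1) (\<lambda>v. v \<bullet> (M *v v))"
    by (intro continuous_intros matrix_vector_mult_linear_continuous_on)
  then obtain w where w: "w \<in> sphere 0 1" "\<And>v. v \<in> sphere 0 1 \<Longrightarrow> w \<bullet> (M *v w) \<le> v \<bullet> (M *v v)"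
    using continuous_attains_inf[of "sphere (0::real^'n) 1" "\<lambda>v. v \<bullet> (M *v v)"] by auto
  show ?thesis
  proof
    show "0 < w \<bullet> (M *v w)" using w(1) assms[of w] by force
    show "w \<bullet> (M *v w) * (norm v)\<^sup>2 \<le> v \<bullet> (M *v v)" for v
    proof (cases "v = 0")
      case False
      let ?s = "inverse (norm v) *\<^sub>R v"
      have "w \<bullet> (M *v w) \<le> ?s \<bullet> (M *v ?s)" using False by (intro w(2)) auto
      also have "\<dots> = v \<bullet> (M *v v) / (norm v)\<^sup>2"
        by (simp add: matrix_vector_mult_scaleR power2_eq_square divide_simps)
      finally show ?thesis using False by (simp add: field_simps)
    qed simp
  qed
qed

lemma quadratic_form_upper_bound:
  fixes M :: "real^'n^'n"
  obtains m where "0 < m" "\<And>u v. \<bar>u \<bullet> (M *v v)\<bar> \<le> m * norm u * norm v"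
proof -
  obtain K where K: "0 < K" "\<And>v. norm (M *v v) \<le> norm v * K"
    using bounded_linear.pos_bounded[OF matrix_vector_mul_bounded_linear] by blast
  have "\<bar>u \<bullet> (M *v v)\<bar> \<le> K * norm u * norm v" for u v
    using Cauchy_Schwarz_ineq2[of u "M *v v"] mult_left_mono[OF K(2)[of v] norm_ge_zero[of u]]
    by (simp add: ac_simps)
  with K(1) that show ?thesis by blast
qed

lemma positive_definite_inner_commute:
  "positive_definite Y \<Longrightarrow> u \<bullet> (Y *v w) = w \<bullet> (Y *v u)"
  unfolding positive_definite_def
  by (metis dot_lmul_matrix inner_commute transpose_matrix_vector)

text \<open>The Lyapunov matrix is \<open>Y\<close> times the Jacobian plus the transpose of this
  product, and transposes have the same quadratic form.\<close>

lemma inner_lyapunov_matrix: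
  assumes "positive_definite Y"
  shows "v \<bullet> (lyapunov_matrix g S Y z *v v) = 2 * (v \<bullet> (Y *v (jacobian g (at z within S) *v v)))"
proof -
  let ?J = "jacobian g (at z within S)"
  have "v \<bullet> (transpose ?J *v (Y *v v)) = (?J *v v) \<bullet> (Y *v v)"
    by (metis dot_lmul_matrix inner_commute transpose_matrix_vector)
  also have "\<dots> = v \<bullet> (Y *v (?J *v v))" by (rule positive_definite_inner_commute[OF assms])
  finally show ?thesis
    by (simp add: lyapunov_matrix_def matrix_vector_mult_add_rdistrib inner_add_right
        flip: matrix_vector_mul_assoc)
qed

text \<open>Collects what the stability argument uses of the desingularized field. Lipschitz
  continuity is required separately off the horizon and along it, not across it. The factorization
  in \<open>b\<close>, with continuous cofactor, makes the horizon invariant and forbids reaching it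
  in finite time.\<close>

locale lyapunov_basin =
  fixes g :: "real^'n \<Rightarrow> real^'n" and i :: "'n::finite" and Y :: "real^'n^'n" and p :: "real^'n"
    and \<epsilon> :: real and b :: "real^'n \<Rightarrow> real"
  assumes Y: "positive_definite Y" and p: "p $ i = 0" "g p = 0" and \<epsilon>: "0 < \<epsilon>"
    and diff: "\<And>z. z \<in> sublevel i Y p \<epsilon> \<Longrightarrow> g differentiable (at z within phase_space i)"
    and neg: "\<And>z. z \<in> sublevel i Y p \<epsilon> \<Longrightarrow> negative_definite (lyapunov_matrix g (phase_space i) Y z)"
    and lip_interior: "\<And>K a. compact K \<Longrightarrow> 0 < a \<Longrightarrow> K \<subseteq> {z. a \<le> z $ i} \<Longrightarrow> lipschitzian_on K g"
    and lip_horizon: "\<And>K. compact K \<Longrightarrow> K \<subseteq> horizon i \<Longrightarrow> lipschitzian_on K g"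
    and b: "\<And>z. z \<in> phase_space i \<Longrightarrow> g z $ i = z $ i * b z" "continuous_on (phase_space i) b"
begin

abbreviation "H \<equiv> phase_space i"
abbreviation "N \<equiv> sublevel i Y p \<epsilon>"
abbreviation "L \<equiv> lyapunov_function Y p"
abbreviation "q v \<equiv> v \<bullet> (Y *v v)"

section \<open>The Lyapunov function and the geometry of its sublevel set\<close>

lemmas comm = positive_definite_inner_commute[OF Y]

lemma L_p: "L p = 0" by (simp add: lyapunov_function_def)

lemma L_nonneg: "0 \<le> L z"
  using Y by (cases "z = p") (auto simp: lyapunov_function_def positive_definite_def less_imp_le)

lemma q_pos: "v \<noteq> 0 \<Longrightarrow> 0 < q v" using Y by (auto simp: positive_definite_def)

lemma q_nonneg: "0 \<le> q v" using q_pos[of v] by (cases "v = 0") auto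

lemma L_bounds:
  obtains m M where "0 < m" "0 < M"
    "\<And>z. m * (norm (z - p))\<^sup>2 \<le> L z" "\<And>z. L z \<le> M * (norm (z - p))\<^sup>2"
proof -
  obtain m where m: "0 < m" "\<And>v. m * (norm v)\<^sup>2 \<le> q v"
    using quadratic_form_lower_bound[of Y] q_pos by blast
  obtain M where M: "0 < M" "\<And>u v. \<bar>u \<bullet> (Y *v v)\<bar> \<le> M * norm u * norm v"
    using quadratic_form_upper_bound[of Y] by blast
  have "q v \<le> M * (norm v)\<^sup>2" for v using M(2)[of v v] by (simp add: power2_eq_square mult.assoc)
  with m M(1) that show ?thesis unfolding lyapunov_function_def by blast
qed

lemma continuous_on_L: "continuous_on S L"
  unfolding lyapunov_function_def
  by (intro continuous_intros matrix_vector_mult_linear_continuous_on continuous_on_compose2[OF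
      matrix_vector_mult_linear_continuous_on[of UNIV Y]]) auto

lemma p_in_H: "p \<in> H" using p by (simp add: phase_space_def)

lemma p_in_N: "p \<in> N" using p_in_H \<epsilon> by (simp add: sublevel_def L_p)

lemma N_subset_H: "N \<subseteq> H" by (auto simp: sublevel_def)

lemma closed_H: "closed H"
  unfolding phase_space_def by (intro closed_Collect_le continuous_intros)

lemma closed_sublevel: "closed (sublevel i Y p r)"
proof -
  have "sublevel i Y p r = H \<inter> {z. L z \<le> r}" by (auto simp: sublevel_def)
  then show ?thesis
    by (simp add: closed_Int closed_H closed_Collect_le continuous_on_L)
qed

lemma compact_N: "compact N"
proof -
  obtain m where m: "0 < m" "\<And>z. m * (norm (z - p))\<^sup>2 \<le> L z" using L_bounds by metis
  have "N \<subseteq> cball p (sqrt (\<epsilon> / m))"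
  proof
    fix z assume "z \<in> N"
    then have "m * (norm (z - p))\<^sup>2 \<le> \<epsilon>" using m(2)[of z] by (auto simp: sublevel_def)
    then show "z \<in> cball p (sqrt (\<epsilon> / m))"
      using m(1) by (auto simp: dist_norm norm_minus_commute field_simps intro!: real_le_rsqrt)
  qed
  then show ?thesis using closed_sublevel bounded_cball bounded_subset compact_eq_bounded_closed by blast
qed

lemma convex_N: "convex N"
proof (rule convexI)
  fix x y :: "real^'n" and u v :: real
  assume xy: "x \<in> N" "y \<in> N" and uv: "0 \<le> u" "0 \<le> v" "u + v = 1"
  have u: "u = 1 - v" using uv by simp
  have eq: "u *\<^sub>R x + v *\<^sub>R y - p = (x - p) + v *\<^sub>R ((y - p) - (x - p))"
    unfolding u by (simp add: algebra_simps)
  \<comment> \<open>Exact expansion of the quadratic form at a convex combination; its last term is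
    subtracted and nonnegative, which yields convexity of \<open>L\<close>.\<close>
  have quad: "q (c + v *\<^sub>R (d - c)) = (1 - v) * q c + v * q d - (1 - v) * v * q (d - c)" for c d
    using comm[of c d]
    by (simp add: matrix_vector_right_distrib matrix_vector_mult_diff_distrib
        matrix_vector_mult_scaleR inner_add_left inner_add_right inner_diff_left inner_diff_right)
      (simp add: algebra_simps power2_eq_square)
  have "L (u *\<^sub>R x + v *\<^sub>R y) \<le> u * L x + v * L y"
  proof -
    have "0 \<le> (1 - v) * v * q ((y - p) - (x - p))"
      using uv by (intro mult_nonneg_nonneg q_nonneg) auto
    then show ?thesis unfolding lyapunov_function_def eq quad[of "x - p" "y - p"] by (simp add: u)
  qed
  also have "\<dots> \<le> u * \<epsilon> + v * \<epsilon>"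
    using xy uv by (intro add_mono mult_left_mono) (auto simp: sublevel_def)
  finally have "L (u *\<^sub>R x + v *\<^sub>R y) \<le> \<epsilon>" using uv by (simp flip: distrib_right)
  then show "u *\<^sub>R x + v *\<^sub>R y \<in> N"
    using xy uv by (auto simp: sublevel_def phase_space_def)
qed

lemma continuous_on_g: "continuous_on N g"
proof -
  have "continuous (at z within N) g" if "z \<in> N" for z
    using diff[OF that] N_subset_H
    by (meson continuous_within_subset differentiable_imp_continuous_within)
  then show ?thesis by (simp add: continuous_on_eq_continuous_within)
qed

section \<open>Dissipativity, decay of the Lyapunov function and uniqueness\<close>

lemma neg': "z \<in> N \<Longrightarrow> v \<noteq> 0 \<Longrightarrow> v \<bullet> (Y *v (jacobian g (at z within H) *v v)) < 0"
  using neg[of z] inner_lyapunov_matrix[OF Y, of v g H z] by (auto simp: negative_definite_def)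

text \<open>Along the segment from \<open>y\<close> to \<open>x\<close>, which lies in
  \<open>N\<close> by convexity, the function \<open>t \<mapsto> (x - y) \<bullet> (Y *v g (y + t
  *\<^sub>R (x - y)))\<close> has negative derivative; its values at 1 and 0 are compared.\<close>

lemma dissipative_strict:
  assumes x: "x \<in> N" and y: "y \<in> N" and ne: "x \<noteq> y"
  shows "(x - y) \<bullet> (Y *v (g x - g y)) < 0"
proof -
  let ?v = "x - y" and ?\<gamma> = "\<lambda>t. y + t *\<^sub>R (x - y)"
  let ?\<phi> = "\<lambda>t. ?v \<bullet> (Y *v g (?\<gamma> t))"
  have seg: "?\<gamma> t \<in> N" if "t \<in> {0..1}" for t
  proof -
    have "?\<gamma> t = (1 - t) *\<^sub>R y + t *\<^sub>R x" by (simp add: algebra_simps)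
    then show ?thesis using convexD[OF convex_N y x, of "1 - t" t] that by simp
  qed
  have der: "(?\<phi> has_real_derivative ?v \<bullet> (Y *v (jacobian g (at (?\<gamma> t) within H) *v ?v))) (at t within {0..1})"
    if "t \<in> {0..1}" for t
  proof -
    let ?J = "jacobian g (at (?\<gamma> t) within H)"
    have "(g has_derivative (\<lambda>h. ?J *v h)) (at (?\<gamma> t) within H)"
      using diff[OF seg[OF that]] jacobian_works by blast
    \<comment> \<open>Restricting the derivative within \<open>H\<close> to the segment makes the
      chain rule applicable even where the segment runs in the horizon.\<close>
    then have "(g has_derivative (\<lambda>h. ?J *v h)) (at (?\<gamma> t) within ?\<gamma> ` {0..1})"
      by (rule has_derivative_subset) (use seg N_subset_H in blast)
    then have "((\<lambda>t. g (?\<gamma> t)) has_derivative (\<lambda>h. ?J *v (h *\<^sub>R ?v))) (at t within {0..1})"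
      by (rule has_derivative_in_compose[rotated]) (auto intro!: derivative_eq_intros)
    then have "((\<lambda>t. ?v \<bullet> (Y *v g (?\<gamma> t))) has_derivative (\<lambda>h. ?v \<bullet> (Y *v (?J *v (h *\<^sub>R ?v))))) (at t within {0..1})"
      by (intro bounded_linear.has_derivative[OF bounded_linear_inner_right]
          bounded_linear.has_derivative[OF matrix_vector_mul_bounded_linear])
    moreover have "(\<lambda>h. ?v \<bullet> (Y *v (?J *v (h *\<^sub>R ?v)))) = (*) (?v \<bullet> (Y *v (?J *v ?v)))"
      by (auto simp: matrix_vector_mult_scaleR)
    ultimately show ?thesis by (simp add: has_field_derivative_def)
  qed
  have "?\<phi> 1 < ?\<phi> 0"
  proof (rule DERIV_neg_imp_decreasing_open[where a = 0 and b = 1])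
    show "\<exists>y. DERIV ?\<phi> t :> y \<and> y < 0" if "0 < t" "t < 1" for t
      using der[of t] neg'[OF seg, of t ?v] ne that by (force simp: at_within_Icc_at)
    show "continuous_on {0..1} ?\<phi>" using der by (rule DERIV_continuous_on)
  qed simp
  then show ?thesis
    by (simp add: matrix_vector_mult_diff_distrib inner_diff_right)
qed

lemma dissipative: "x \<in> N \<Longrightarrow> y \<in> N \<Longrightarrow> (x - y) \<bullet> (Y *v (g x - g y)) \<le> 0"
  using dissipative_strict[of x y] by (cases "x = y") (auto simp: less_imp_le)

lemma q_has_derivative:
  assumes "(u has_vector_derivative u') (at t within X)"
  shows "((\<lambda>t. q (u t)) has_real_derivative 2 * (u t \<bullet> (Y *v u'))) (at t within X)"
proof -
  have "((\<lambda>t. Y *v u t) has_vector_derivative Y *v u') (at t within X)"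
    using assms by (rule bounded_linear.has_vector_derivative[OF matrix_vector_mul_bounded_linear])
  from bounded_bilinear.has_vector_derivative[OF bounded_bilinear_inner assms this]
  show ?thesis
    using comm[of u' "u t"] by (simp add: has_real_derivative_iff_has_vector_derivative)
qed

lemma L_has_derivative:
  assumes "(u has_vector_derivative u') (at t within X)"
  shows "((\<lambda>t. L (u t)) has_real_derivative 2 * ((u t - p) \<bullet> (Y *v u'))) (at t within X)"
  unfolding lyapunov_function_def
  by (rule q_has_derivative) (use assms in \<open>auto intro!: derivative_eq_intros\<close>)

text \<open>Dissipativity is applied to the pair \<open>u t\<close> and \<open>p\<close>, where
  \<open>g p = 0\<close>.\<close>

lemma L_decreasing:
  assumes "solves g N {a..c} u" "a \<le> c"
  shows "L (u c) \<le> L (u a)"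
proof (rule DERIV_nonpos_imp_decreasing_within[OF assms(2)])
  fix t assume "t \<in> {a..c}"
  then have t: "u t \<in> N" "(u has_vector_derivative g (u t)) (at t within {a..c})"
    using assms by (auto simp: solves_def)
  from L_has_derivative[OF t(2)] show "((\<lambda>t. L (u t)) has_real_derivative 2 * ((u t - p) \<bullet> (Y *v g (u t)))) (at t within {a..c})" .
  show "2 * ((u t - p) \<bullet> (Y *v g (u t))) \<le> 0" using dissipative[OF t(1) p_in_N] p by simp
qed

text \<open>The squared distance of two solutions in the \<open>Y\<close>-norm is nonincreasing by
  dissipativity. This argument works up to the horizon, where no Lipschitz bound is at hand.\<close>

lemma solution_unique:
  assumes u: "solves g N {0..T} u" and v: "solves g N {0..T} v" and "u 0 = v 0" and t: "t \<in> {0..T}"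
  shows "u t = v t"
proof -
  have "q (u t - v t) \<le> q (u 0 - v 0)"
  proof (rule DERIV_nonpos_imp_decreasing_within[where a = 0 and b = t])
    fix s assume "s \<in> {0..t}"
    then have s: "u s \<in> N" "(u has_vector_derivative g (u s)) (at s within {0..t})"
       "v s \<in> N" "(v has_vector_derivative g (v s)) (at s within {0..t})"
      using t solves_subset[OF u, of "{0..t}" N] solves_subset[OF v, of "{0..t}" N]
      by (auto simp: solves_def)
    show "((\<lambda>s. q (u s - v s)) has_real_derivative 2 * ((u s - v s) \<bullet> (Y *v (g (u s) - g (v s))))) (at s within {0..t})"
      by (intro q_has_derivative has_vector_derivative_diff s)
    show "2 * ((u s - v s) \<bullet> (Y *v (g (u s) - g (v s)))) \<le> 0" using dissipative s by simp
  qed (use t in auto)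
  then show ?thesis using q_pos[of "u t - v t"] \<open>u 0 = v 0\<close> by auto
qed

text \<open>While the solution is in \<open>N\<close>, its \<open>L\<close>-value stays at most the
  initial one, which is strictly below \<open>\<epsilon>\<close>; continuity then gives the room for
  a barrier step.\<close>

lemma solves_stays:
  assumes u: "solves g H {0..T} u" and "L (u 0) < \<epsilon>"
  shows "solves g N {0..T} u"
proof -
  have "u t \<in> N" if "t \<in> {0..T}" for t
  proof (rule barrier[OF closed_sublevel solves_continuous_on[OF u] _ _ that])
    show "u 0 \<in> N" using assms that by (auto simp: solves_def sublevel_def)
    fix t assume t: "0 \<le> t" "t < T" "u ` {0..t} \<subseteq> N"
    then have "solves g N {0..t} u"
      using solves_subset[OF u, of "{0..t}" H] by (auto simp: solves_def)
    then have "L (u t) < \<epsilon>" using L_decreasing[of 0 t u] t assms by simp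
    moreover have "continuous_on {0..T} (\<lambda>s. L (u s))"
      by (intro continuous_on_compose2[OF continuous_on_L[of UNIV] solves_continuous_on[OF u]]) auto
    then have "((\<lambda>s. L (u s)) \<longlongrightarrow> L (u t)) (at t within {0..T})"
      using t by (auto simp: continuous_on_def)
    ultimately have "eventually (\<lambda>s. L (u s) < \<epsilon>) (at t within {0..T})" by (auto dest: order_tendstoD)
    moreover have "eventually (\<lambda>s. s \<in> {0..T}) (at t within {0..T})" by (simp add: eventually_at_filter)
    ultimately show "eventually (\<lambda>s. u s \<in> N) (at t within {0..T})"
      by eventually_elim (use u in \<open>auto simp: solves_def sublevel_def\<close>)
  qed
  then show ?thesis using u by (auto simp: solves_def)
qed

lemma solves_stays_Ici:
  "solves g H {0..} u \<Longrightarrow> L (u 0) < \<epsilon> \<Longrightarrow> solves g N {0..} u"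
  unfolding solves_Ici_iff using solves_stays by blast

text \<open>The component obeys \<open>s' = s * b\<close>, hence \<open>s' >= - M * s\<close>;
  Gronwall is applied to its negative.\<close>

lemma component_lower_bound:
  assumes u: "solves g H {0..T} u" and "0 < u 0 $ i" and t: "t \<in> {0..T}"
    and M: "\<And>s. s \<in> {0..t} \<Longrightarrow> \<bar>b (u s)\<bar> \<le> M"
  shows "u 0 $ i * exp (- M * t) \<le> u t $ i"
proof -
  have "- (u t $ i) \<le> - (u 0 $ i) * exp (- M * (t - 0))"
  proof (rule gronwall[where v = "\<lambda>s. - (u s $ i)" and a = 0])
    fix s assume s: "s \<in> {0..t}"
    then have "(u has_vector_derivative g (u s)) (at s within {0..t})" and us: "u s \<in> H"
      using t solves_subset[OF u, of "{0..t}" H] by (auto simp: solves_def)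
    then have "((\<lambda>s. - (u s $ i)) has_vector_derivative - (g (u s) $ i)) (at s within {0..t})"
      by (intro has_vector_derivative_minus bounded_linear.has_vector_derivative[OF bounded_linear_vec_nth])
    then show "((\<lambda>s. - (u s $ i)) has_real_derivative - (u s $ i * b (u s))) (at s within {0..t})"
      using b us by (simp add: has_real_derivative_iff_has_vector_derivative)
    have "u s $ i * (- b (u s)) \<le> u s $ i * M"
      using M[OF s] us by (intro mult_left_mono) (auto simp: phase_space_def)
    then show "- (u s $ i * b (u s)) \<le> - M * - (u s $ i)" by (simp add: mult.commute)
  qed (use t in auto)
  then show ?thesis by simp
qed

text \<open>Along a compact piece of trajectory the cofactor \<open>b\<close> is bounded, so the
  component decays at most exponentially and cannot vanish in finite time.\<close>

lemma component_positive:
  assumes u: "solves g H {0..T} u" and "0 < u 0 $ i" and t: "t \<in> {0..T}"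
  shows "0 < u t $ i"
proof -
  have "compact ((\<lambda>s. b (u s)) ` {0..T})"
    using u solves_continuous_on[OF u]
    by (intro compact_continuous_image continuous_on_compose2[OF b(2)]) (auto simp: solves_def)
  then obtain M where "\<forall>y\<in>(\<lambda>s. b (u s)) ` {0..T}. norm y \<le> M"
    using compact_imp_bounded bounded_iff by blast
  then have "u 0 $ i * exp (- M * t) \<le> u t $ i"
    using t by (intro component_lower_bound[OF u assms(2) t]) auto
  with assms(2) show ?thesis by (smt (verit) exp_gt_zero mult_pos_pos)
qed

section \<open>Existence of solutions in the basin\<close>

text \<open>A barrier argument for the truncated equation. The constraint
  \<open>L < \<epsilon>\<close> near \<open>t\<close> is supplied here by decay of \<open>L\<close>,
  so \<open>step\<close> has to provide only the remaining constraints that define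
  \<open>C\<close>.\<close>

lemma local_existence:
  assumes C: "compact C" "convex C" "x0 \<in> C" "C \<subseteq> N" and lip: "lipschitzian_on C g" and x0: "L x0 < \<epsilon>"
    and step: "\<And>u t. u 0 = x0 \<Longrightarrow>
        (\<And>s. 0 \<le> s \<Longrightarrow> (u has_vector_derivative g (closest_point C (u s))) (at s within {0..})) \<Longrightarrow>
        0 \<le> t \<Longrightarrow> t < T \<Longrightarrow> solves g C {0..t} u \<Longrightarrow>
        eventually (\<lambda>s. L (u s) < \<epsilon> \<longrightarrow> u s \<in> C) (at t within {0..T})"
  obtains u where "u 0 = x0" "solves g C {0..T} u"
proof -
  obtain u where u0: "u 0 = x0" and
    du: "\<And>t. 0 \<le> t \<Longrightarrow> (u has_vector_derivative g (closest_point C (u t))) (at t within {0..})"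
    using truncated_ode_solution[OF C(1-3) lip] by blast
  have der: "(u has_vector_derivative g (u t)) (at t within {0..r})" if "t \<in> {0..r}" "u t \<in> C" for t r
    using du[of t] that by (auto simp: closest_point_self intro: has_vector_derivative_within_subset)
  have "continuous_on {0..} u"
    using du by (meson atLeast_iff continuous_on_eq_continuous_within has_vector_derivative_continuous)
  then have cont: "continuous_on {0..r} u" for r by (rule continuous_on_subset) auto
  have "u t \<in> C" if "t \<in> {0..T}" for t
  proof (rule barrier[OF _ cont _ _ that])
    show "closed C" using C compact_imp_closed by blast
    show "u 0 \<in> C" using C u0 by simp
    fix t assume t: "0 \<le> t" "t < T" "u ` {0..t} \<subseteq> C"
    then have sol: "solves g C {0..t} u" using der by (auto simp: solves_def)
    then have "L (u t) < \<epsilon>" using L_decreasing[of 0 t u] solves_subset[OF sol subset_refl C(4)] t x0 u0 by simp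
    moreover have "continuous_on {0..T} (\<lambda>s. L (u s))"
      by (intro continuous_on_compose2[OF continuous_on_L[of UNIV] cont]) auto
    then have "((\<lambda>s. L (u s)) \<longlongrightarrow> L (u t)) (at t within {0..T})"
      using t by (auto simp: continuous_on_def)
    ultimately have "eventually (\<lambda>s. L (u s) < \<epsilon>) (at t within {0..T})" by (auto dest: order_tendstoD)
    with step[OF u0 du t(1,2) sol] show "eventually (\<lambda>s. u s \<in> C) (at t within {0..T})"
      by (auto elim: eventually_elim2)
  qed
  then have "solves g C {0..T} u" using der by (auto simp: solves_def)
  with u0 that show ?thesis by blast
qed

lemma local_existence_interior:
  assumes x0: "0 < x0 $ i" "L x0 < \<epsilon>" and T: "0 \<le> T"
  obtains u where "u 0 = x0" "solves g N {0..T} u"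
proof -
  have "compact (b ` N)"
    using compact_N b(2) N_subset_H continuous_on_subset compact_continuous_image by blast
  then obtain M where M: "\<forall>y\<in>b ` N. norm y \<le> M" using compact_imp_bounded bounded_iff by blast
  then have M0: "0 \<le> M" using p_in_N by fastforce
  \<comment> \<open>Half of the smallest value that the exponential lower bound allows up to time
    \<open>T\<close>. The truncated solution therefore stays strictly above level \<open>a\<close>,
    and \<open>g\<close> is Lipschitz on \<open>C\<close>.\<close>
  define a where "a = x0 $ i * exp (- M * T) / 2"
  define C where "C = N \<inter> {z. a \<le> z $ i}"
  have a: "0 < a" "a < x0 $ i * exp (- M * T)" using x0 by (auto simp: a_def)
  have "exp (- M * T) \<le> 1" using M0 T by simp
  then have "x0 $ i * exp (- M * T) \<le> x0 $ i" using x0 by (intro mult_left_le) auto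
  with a have "a \<le> x0 $ i" by linarith
  then have x0C: "x0 \<in> C" using x0 by (auto simp: C_def sublevel_def phase_space_def)
  have cv: "convex {z. a \<le> z $ i}"
    using convex_halfspace_ge[of a "axis i 1 :: real^'n"] by (simp add: inner_axis')
  have cl: "closed {z. a \<le> z $ i}"
    by (intro closed_Collect_le continuous_intros)
  have cC: "compact C" "convex C"
    unfolding C_def using compact_N convex_N cv cl by (auto intro: convex_Int)
  show ?thesis
  proof (rule local_existence[of C x0 T])
    show "lipschitzian_on C g" by (rule lip_interior[OF cC(1) a(1)]) (auto simp: C_def)
    fix u t assume u0: "u 0 = x0" and t: "0 \<le> t" "t < T" and u: "solves g C {0..t} u"
      and du: "\<And>s. 0 \<le> s \<Longrightarrow> (u has_vector_derivative g (closest_point C (u s))) (at s within {0..})"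
    have "x0 $ i * exp (- M * t) \<le> u t $ i"
      unfolding u0[symmetric]
    proof (rule component_lower_bound)
      show "solves g H {0..t} u"
        using u N_subset_H by (auto intro!: solves_subset[OF u] simp: C_def)
      show "\<bar>b (u s)\<bar> \<le> M" if "s \<in> {0..t}" for s
        using M u that by (auto simp: solves_def C_def)
    qed (use u0 x0 t in auto)
    moreover have "x0 $ i * exp (- M * T) \<le> x0 $ i * exp (- M * t)"
      using t M0 x0 by (simp add: mult_left_mono)
    ultimately have "a < u t $ i" using a by linarith
    moreover have "continuous (at t within {0..T}) u"
      by (rule continuous_within_subset[OF has_vector_derivative_continuous[OF du[OF t(1)]]]) auto
    then have "((\<lambda>s. u s $ i) \<longlongrightarrow> u t $ i) (at t within {0..T})"
      by (auto simp: continuous_within intro: tendsto_vec_nth)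
    ultimately have "eventually (\<lambda>s. a < u s $ i) (at t within {0..T})" by (auto dest: order_tendstoD)
    then show "eventually (\<lambda>s. L (u s) < \<epsilon> \<longrightarrow> u s \<in> C) (at t within {0..T})"
      by eventually_elim (use a in \<open>auto simp: C_def sublevel_def phase_space_def\<close>)
  next
    fix u assume "u 0 = x0" "solves g C {0..T} u"
    then show thesis using that[of u] by (auto simp: C_def intro: solves_subset)
  qed (use x0C x0 cC in \<open>auto simp: C_def\<close>)
qed

lemma local_existence_horizon:
  assumes x0: "x0 $ i = 0" "L x0 < \<epsilon>"
  obtains u where "u 0 = x0" "solves g N {0..T} u"
proof -
  define C where "C = N \<inter> horizon i"
  have x0C: "x0 \<in> C" using x0 by (auto simp: C_def sublevel_def phase_space_def horizon_def)
  have cv: "convex (horizon i)" by (auto simp: convex_def horizon_def)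
  have cl: "closed (horizon i)"
    unfolding horizon_def by (intro closed_Collect_eq continuous_intros)
  have cC: "compact C" "convex C"
    unfolding C_def using compact_N convex_N cv cl by (auto intro: convex_Int)
  show ?thesis
  proof (rule local_existence[of C x0 T])
    show "lipschitzian_on C g" by (rule lip_horizon[OF cC(1)]) (auto simp: C_def)
    fix u t assume u0: "u 0 = x0" and t: "0 \<le> t" "t < T"
      and du: "\<And>s. 0 \<le> s \<Longrightarrow> (u has_vector_derivative g (closest_point C (u s))) (at s within {0..})"
    have "closest_point C x \<in> C" for x
      using cC x0C by (intro closest_point_in_set) (auto dest: compact_imp_closed)
    \<comment> \<open>The cofactor form of \<open>g\<close> makes its component normal to the
      horizon vanish there, so the truncated solution never leaves the horizon.\<close>
    then have gi: "g (closest_point C x) $ i = 0" for x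
      using b(1) N_subset_H by (fastforce simp: C_def horizon_def)
    have "u s $ i = 0" if "0 \<le> s" for s
    proof -
      have "((\<lambda>s. u s $ i) has_vector_derivative 0) (at r within {0..})" if "0 \<le> r" for r
        using bounded_linear.has_vector_derivative[OF bounded_linear_vec_nth du[OF that], of i] gi by simp
      from has_vector_derivative_zero_constant[OF convex_real_interval(1)[of 0] this] that
      obtain c where "\<And>r. 0 \<le> r \<Longrightarrow> u r $ i = c" by force
      then show ?thesis using that u0 x0 by force
    qed
    moreover have "eventually (\<lambda>s. 0 \<le> s) (at t within {0..T})" by (simp add: eventually_at_filter)
    ultimately show "eventually (\<lambda>s. L (u s) < \<epsilon> \<longrightarrow> u s \<in> C) (at t within {0..T})"
      by (auto elim!: eventually_mono simp: C_def sublevel_def phase_space_def horizon_def)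
  next
    fix u assume "u 0 = x0" "solves g C {0..T} u"
    then show thesis using that[of u] by (auto simp: C_def intro: solves_subset)
  qed (use x0C x0 cC in \<open>auto simp: C_def\<close>)
qed

lemma global_existence:
  assumes x0: "x0 \<in> H" "L x0 < \<epsilon>"
  obtains u where "u 0 = x0" "solves g N {0..} u" "0 < x0 $ i \<Longrightarrow> \<forall>t\<ge>0. 0 < u t $ i"
proof -
  have "\<exists>u. u 0 = x0 \<and> solves g N {0..real n} u" for n
  proof (cases "x0 $ i = 0")
    case True then show ?thesis using local_existence_horizon x0(2) by metis
  next
    case False
    then have "0 < x0 $ i" using x0(1) by (simp add: phase_space_def)
    then show ?thesis using local_existence_interior[of x0 "real n"] x0(2) by (metis of_nat_0_le_iff)
  qed
  \<comment> \<open>Solutions on the intervals from 0 to \<open>n\<close> agree on overlaps by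
    uniqueness and are glued into one on the half-line.\<close>
  then obtain U where U: "\<And>n. U n 0 = x0" "\<And>n. solves g N {0..real n} (U n)" by metis
  have eq: "U m t = U n t" if "0 \<le> t" "t \<le> real m" "m \<le> n" for m n t
    by (rule solution_unique[of "real m"]) (use U that in \<open>auto intro: solves_subset[OF U(2)[of n]]\<close>)
  \<comment> \<open>The index is the least \<open>n\<close> whose interval contains
    \<open>t\<close>; every larger index gives the same value.\<close>
  define w where "w t = U (nat \<lceil>t\<rceil>) t" for t
  have w: "w t = U n t" if "0 \<le> t" "t \<le> real n" for n t
  proof -
    have "nat \<lceil>t\<rceil> \<le> n" "t \<le> real (nat \<lceil>t\<rceil>)" using that by linarith+
    then show ?thesis unfolding w_def using eq that by blast
  qed
  have sol: "solves g N {0..T} w" for T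
  proof -
    obtain n where n: "T \<le> real n" using real_arch_simple by blast
    have "solves g N {0..real n} w"
      unfolding solves_def
    proof (intro ballI conjI)
      fix t assume t: "t \<in> {0..real n}"
      then show "w t \<in> N" using U(2)[of n] w by (auto simp: solves_def)
      have "(U n has_vector_derivative g (U n t)) (at t within {0..real n})"
        using U(2)[of n] t by (auto simp: solves_def)
      then show "(w has_vector_derivative g (w t)) (at t within {0..real n})"
        using w[of t n] t by (auto intro: has_vector_derivative_transform[of t _ w "U n"] simp: w)
    qed
    then show ?thesis using n by (auto intro: solves_subset)
  qed
  have w0: "w 0 = x0" using w[of 0 0] U(1) by simp
  show ?thesis
  proof (rule that[of w])
    show "w 0 = x0" by (rule w0)
    show "solves g N {0..} w" using sol solves_Ici_iff by blast
    assume "0 < x0 $ i"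
    then show "\<forall>t\<ge>0. 0 < w t $ i"
      using component_positive[OF solves_subset[OF sol subset_refl N_subset_H], of _ ] w0
      by (metis atLeastAtMost_iff order_refl)
  qed
qed

section \<open>Asymptotic stability of the equilibrium\<close>

lemma sublevel_nbhd:
  assumes "0 < e"
  obtains r where "0 < r" "\<And>z. L z < r \<Longrightarrow> dist z p < e"
proof -
  obtain m where m: "0 < m" "\<And>z. m * (norm (z - p))\<^sup>2 \<le> L z" using L_bounds by metis
  show ?thesis
  proof
    show "0 < m * e\<^sup>2" using m assms by simp
    show "dist z p < e" if "L z < m * e\<^sup>2" for z
    proof -
      have "m * (norm (z - p))\<^sup>2 < m * e\<^sup>2" using m(2)[of z] that by linarith
      then have "(norm (z - p))\<^sup>2 < e\<^sup>2" using m(1) by simp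
      then show ?thesis using assms by (simp add: dist_norm power_less_imp_less_base)
    qed
  qed
qed

lemma nbhd_sublevel:
  assumes "0 < r"
  obtains d where "0 < d" "\<And>z. dist z p < d \<Longrightarrow> L z < r"
proof -
  have "isCont L p" using continuous_on_L[of UNIV] by (simp add: continuous_on_eq_continuous_at)
  then have "(L \<longlongrightarrow> 0) (nhds p)" using L_p by (metis isCont_def tendsto_at_iff_tendsto_nhds)
  then have "eventually (\<lambda>z. L z < r) (nhds p)" using assms by (auto dest: order_tendstoD)
  then show ?thesis using that unfolding eventually_nhds_metric by blast
qed

text \<open>If the nonincreasing \<open>L\<close> stayed above some \<open>r > 0\<close>, the
  trajectory would remain in a compact set avoiding \<open>p\<close>, where \<open>L\<close> falls
  at a uniform positive rate; it would then become negative.\<close>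

lemma attraction:
  assumes u: "solves g N {0..} u"
  shows "(u \<longlongrightarrow> p) at_top"
proof -
  have mono: "L (u t) \<le> L (u s)" if "0 \<le> s" "s \<le> t" for s t
    using L_decreasing[of s t u] solves_subset[OF u, of "{s..t}" N] that by auto
  have "\<exists>t\<ge>0. L (u t) < r" if r: "0 < r" for r
  proof (rule ccontr)
    assume "\<not> (\<exists>t\<ge>0. L (u t) < r)"
    then have ge: "r \<le> L (u t)" if "0 \<le> t" for t using that by force
    define K where "K = N \<inter> {z. r \<le> L z}"
    have uK: "u t \<in> K" if "0 \<le> t" for t using u ge that by (auto simp: K_def solves_def)
    have "compact K" unfolding K_def
      by (intro compact_Int_closed compact_N closed_Collect_le continuous_on_L continuous_intros)
    moreover have "continuous_on K (\<lambda>z. (z - p) \<bullet> (Y *v g z))"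
      by (intro continuous_intros continuous_on_compose2[OF matrix_vector_mult_linear_continuous_on[of UNIV Y]]
          continuous_on_subset[OF continuous_on_g]) (auto simp: K_def)
    moreover have "K \<noteq> {}" using uK by force
    ultimately obtain x where x: "x \<in> K" "\<And>z. z \<in> K \<Longrightarrow> (z - p) \<bullet> (Y *v g z) \<le> (x - p) \<bullet> (Y *v g x)"
      using continuous_attains_sup[of K "\<lambda>z. (z - p) \<bullet> (Y *v g z)"] by blast
    \<comment> \<open>This is minus the maximum over \<open>K\<close> of the derivative of
      \<open>L\<close> along the field; it is positive by strict dissipativity against
      \<open>p\<close>.\<close>
    define m where "m = - 2 * ((x - p) \<bullet> (Y *v g x))"
    have "x \<noteq> p" using x(1) r L_p by (auto simp: K_def)
    then have m: "0 < m" using dissipative_strict[of x p] x(1) p_in_N p by (auto simp: m_def K_def)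
    have "L (u t) + m * t \<le> L (u 0) + m * 0" if t: "0 \<le> t" for t
    proof (rule DERIV_nonpos_imp_decreasing_within[OF t, where v = "\<lambda>s. L (u s) + m * s"])
      fix s assume s: "s \<in> {0..t}"
      then have "(u has_vector_derivative g (u s)) (at s within {0..t})"
        using solves_subset[OF u, of "{0..t}" N] by (auto simp: solves_def)
      then show "((\<lambda>s. L (u s) + m * s) has_real_derivative 2 * ((u s - p) \<bullet> (Y *v g (u s))) + m) (at s within {0..t})"
        by (auto intro!: derivative_eq_intros L_has_derivative)
      show "2 * ((u s - p) \<bullet> (Y *v g (u s))) + m \<le> 0" using x(2)[OF uK, of s] s by (simp add: m_def)
    qed
    \<comment> \<open>At this time the linear decay would force \<open>L\<close> to be at most
      -1.\<close>
    moreover define t where "t = (L (u 0) + 1) / m"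
    moreover have "0 \<le> t" "m * t = L (u 0) + 1"
      using L_nonneg[of "u 0"] m by (auto simp: t_def)
    ultimately show False using L_nonneg[of "u t"] by fastforce
  qed
  note small = this
  show ?thesis
  proof (rule tendstoI)
    fix e :: real assume "0 < e"
    then obtain r where r: "0 < r" "\<And>z. L z < r \<Longrightarrow> dist z p < e" using sublevel_nbhd by metis
    from small[OF r(1)] obtain t where "0 \<le> t" "L (u t) < r" by blast
    then have "dist (u s) p < e" if "t \<le> s" for s using mono[of t s] r(2) that by force
    then show "eventually (\<lambda>s. dist (u s) p < e) at_top" by (auto simp: eventually_at_top_linorder)
  qed
qed

theorem asymptotic_stability: "asymptotically_stable g H p"
proof -
  have "\<exists>d>0. \<forall>z0\<in>H. dist z0 p < d \<longrightarrow>
        (\<exists>z. z 0 = z0 \<and> solves g H {0..} z) \<and>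
        (\<forall>z T. z 0 = z0 \<and> solves g H {0..<T} z \<longrightarrow> (\<forall>t\<in>{0..<T}. dist (z t) p < e))"
    if e: "0 < e" for e
  proof -
    obtain r where r: "0 < r" "\<And>z. L z < r \<Longrightarrow> dist z p < e" using sublevel_nbhd[OF e] by metis
    \<comment> \<open>The bound \<open>\<epsilon>\<close> keeps solutions in the basin, and
      \<open>r\<close> keeps them within distance \<open>e\<close>.\<close>
    obtain d where d: "0 < d" "\<And>z. dist z p < d \<Longrightarrow> L z < min r \<epsilon>" using nbhd_sublevel[of "min r \<epsilon>"] r \<epsilon> by auto
    show ?thesis
    proof (intro exI[of _ d] conjI ballI impI d(1) allI)
      fix z0 assume z0: "z0 \<in> H" "dist z0 p < d"
      show "\<exists>z. z 0 = z0 \<and> solves g H {0..} z"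
        using global_existence[OF z0(1)] d(2)[OF z0(2)] N_subset_H
        by (metis min_less_iff_conj solves_subset subset_refl)
      fix z T t assume z: "z 0 = z0 \<and> solves g H {0..<T} z" and t: "t \<in> {0..<T}"
      then have "solves g H {0..t} z" by (auto intro: solves_subset)
      then have "solves g N {0..t} z" using solves_stays[of t z] z d(2)[OF z0(2)] by simp
      then have "L (z t) \<le> L z0" using L_decreasing[of 0 t z] t z by simp
      then show "dist (z t) p < e" using r(2) d(2)[OF z0(2)] by simp
    qed
  qed
  moreover have "\<exists>d>0. \<forall>z0\<in>H. dist z0 p < d \<longrightarrow>
        (\<forall>z. z 0 = z0 \<and> solves g H {0..} z \<longrightarrow> (z \<longlongrightarrow> p) at_top)"
    using nbhd_sublevel[OF \<epsilon>] solves_stays_Ici attraction by metis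
  ultimately show ?thesis unfolding asymptotically_stable_def using p_in_H p by blast
qed

text \<open>Linearization at \<open>p\<close>: the Jacobian there contributes at most
  \<open>- \<mu> * (norm v)\<^sup>2\<close>, where \<open>v = z - p\<close>, and half of this
  absorbs the remainder. The upper and lower bounds of \<open>L\<close> translate the rest into the
  form with \<open>c1 = 1 / m\<close> and \<open>c = \<mu> * m / M\<close>, so \<open>c * c1\<close>
  is \<open>\<mu> / M\<close>.\<close>

lemma local_exponential_decay:
  obtains r c1 c where "0 < r" "r \<le> \<epsilon>" "0 < c1" "0 < c"
    "\<And>z. (norm (z - p))\<^sup>2 \<le> c1 * L z"
    "\<And>z. z \<in> sublevel i Y p r \<Longrightarrow> 2 * ((z - p) \<bullet> (Y *v g z)) \<le> - c * c1 * L z"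
proof -
  obtain m M where mM: "0 < m" "0 < M"
    "\<And>z. m * (norm (z - p))\<^sup>2 \<le> L z" "\<And>z. L z \<le> M * (norm (z - p))\<^sup>2"
    using L_bounds by metis
  obtain K where K: "0 < K" "\<And>u v. \<bar>u \<bullet> (Y *v v)\<bar> \<le> K * norm u * norm v"
    using quadratic_form_upper_bound[of Y] by blast
  let ?J = "jacobian g (at p within H)"
  have minus: "(- A) *v v = - (A *v v)" for A :: "real^'n^'n" and v
    using matrix_vector_mult_diff_rdistrib[of 0 A v] by simp
  have "0 < v \<bullet> ((- (Y ** ?J)) *v v)" if "v \<noteq> 0" for v
    using neg'[OF p_in_N that] by (simp add: minus matrix_vector_mul_assoc[symmetric])
  then obtain \<mu> where \<mu>: "0 < \<mu>" "\<And>v. \<mu> * (norm v)\<^sup>2 \<le> v \<bullet> ((- (Y ** ?J)) *v v)"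
    using quadratic_form_lower_bound by blast
  have "(g has_derivative (\<lambda>h. ?J *v h)) (at p within H)"
    using diff[OF p_in_N] jacobian_works by blast
  \<comment> \<open>The tolerance \<open>\<mu> / (2 * K)\<close> cancels the norm bound
    \<open>K\<close> of \<open>Y\<close> and leaves half of \<open>\<mu>\<close>.\<close>
  then obtain d where d: "0 < d"
    "\<And>z. z \<in> H \<Longrightarrow> norm (z - p) < d \<Longrightarrow> norm (g z - g p - ?J *v (z - p)) \<le> \<mu> / (2 * K) * norm (z - p)"
    unfolding has_derivative_within_alt using \<mu>(1) K(1) by (metis divide_pos_pos zero_less_mult_iff zero_less_numeral)
  obtain r where r: "0 < r" "\<And>z. L z < r \<Longrightarrow> dist z p < d" using sublevel_nbhd[OF d(1)] by metis
  \<comment> \<open>Sublevel sets are defined with a non-strict inequality, while \<open>r\<close>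
    controls only \<open>L z < r\<close>; hence \<open>r / 2\<close>.\<close>
  have dec: "2 * ((z - p) \<bullet> (Y *v g z)) \<le> - (\<mu> * m / M) * (1 / m) * L z" if "z \<in> sublevel i Y p (min (r / 2) \<epsilon>)" for z
  proof -
    let ?v = "z - p" and ?\<rho> = "g z - ?J *v (z - p)"
    have z: "z \<in> H" "norm ?v < d"
      using that r by (auto simp: sublevel_def dist_norm)
    have "(?v \<bullet> (Y *v g z)) = ?v \<bullet> (Y *v (?J *v ?v)) + ?v \<bullet> (Y *v ?\<rho>)"
      by (simp add: matrix_vector_mult_diff_distrib inner_diff_right)
    moreover have "?v \<bullet> (Y *v (?J *v ?v)) \<le> - \<mu> * (norm ?v)\<^sup>2"
      using \<mu>(2)[of ?v] by (simp add: minus matrix_vector_mul_assoc[symmetric])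
    moreover have "?v \<bullet> (Y *v ?\<rho>) \<le> K * norm ?v * (\<mu> / (2 * K) * norm ?v)"
      using K(2)[of ?v ?\<rho>] d(2)[OF z] p K(1)
      by (smt (verit, best) mult_left_mono mult_nonneg_nonneg norm_ge_zero diff_zero)
    moreover have "K * norm ?v * (\<mu> / (2 * K) * norm ?v) = \<mu> / 2 * (norm ?v)\<^sup>2"
      using K(1) by (simp add: power2_eq_square)
    ultimately have "2 * (?v \<bullet> (Y *v g z)) \<le> - \<mu> * (norm ?v)\<^sup>2" by simp
    moreover have "\<mu> / M * L z \<le> \<mu> / M * (M * (norm ?v)\<^sup>2)"
      using mM \<mu>(1) by (intro mult_left_mono) auto
    moreover have "\<mu> / M * (M * (norm ?v)\<^sup>2) = \<mu> * (norm ?v)\<^sup>2"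
      "- (\<mu> * m / M) * (1 / m) * L z = - (\<mu> / M * L z)" using mM by auto
    ultimately show ?thesis by linarith
  qed
  show ?thesis
  proof (rule that[of "min (r / 2) \<epsilon>" "1 / m" "\<mu> * m / M"])
    show "(norm (z - p))\<^sup>2 \<le> 1 / m * L z" for z using mM(1) mM(3)[of z] by (simp add: field_simps)
  qed (use r \<epsilon> mM \<mu> dec in auto)
qed

end

section \<open>The desingularized field up to the horizon\<close>

text \<open>This is the inverse compactification of \<open>(1, x)\<close>. The point over
  \<open>(s, x)\<close> arises from it by weighted scaling with \<open>1 / s\<close>, so it
  represents the direction in which infinity is approached.\<close>

definition direction_lift :: "'n \<Rightarrow> real \<Rightarrow> real^'n \<Rightarrow> real^'n" where
  "direction_lift i \<sigma> z = (\<chi> j. if j = i then \<sigma> else z $ j)"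

lemma compactification_inv_eq_scaling:
  "compactification_inv \<alpha> i \<sigma> w = weighted_scaling \<alpha> (1 / w $ i) (direction_lift i \<sigma> w)"
  by (simp add: compactification_inv_def weighted_scaling_def direction_lift_def vec_eq_iff power_divide)

lemma weighted_scaling_mult:
  "weighted_scaling \<alpha> a (weighted_scaling \<alpha> b x) = weighted_scaling \<alpha> (a * b) x"
  by (simp add: weighted_scaling_def vec_eq_iff power_mult_distrib)

lemma weighted_scaling_1 [simp]: "weighted_scaling \<alpha> 1 x = x"
  by (simp add: weighted_scaling_def vec_eq_iff)

lemma continuous_on_direction_lift: "continuous_on S (direction_lift i \<sigma>)"
proof -
  have "continuous_on S (\<lambda>z. (if j = i then \<sigma> else z $ j))" for j
    by (cases "j = i") (auto intro!: continuous_intros)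
  then show ?thesis unfolding direction_lift_def by (intro continuous_on_vec_lambda)
qed

text \<open>Intermediate values of the norm of \<open>v\<close> scaled by \<open>1 / \<rho>\<close>:
  it is at least 1 for \<open>\<rho> = 1\<close> and at most 1 for \<open>\<rho> = norm v\<close>,
  since all weights are at least 1. It transfers the asymptotics, uniform on the unit sphere, to
  points of \<open>direction_lift\<close>, whose norm is at least 1.\<close>

lemma weighted_polar_decomposition:
  assumes \<alpha>: "\<And>j. 1 \<le> \<alpha> j" and v: "1 \<le> norm v"
  obtains \<rho> \<theta> where "1 \<le> \<rho>" "\<rho> \<le> norm v" "norm \<theta> = 1" "v = weighted_scaling \<alpha> \<rho> \<theta>"
proof -
  have "\<exists>\<rho>\<ge>1. \<rho> \<le> norm v \<and> norm (weighted_scaling \<alpha> (1 / \<rho>) v) = 1"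
  proof (rule IVT2')
    have le: "\<bar>weighted_scaling \<alpha> (1 / norm v) v $ j\<bar> \<le> \<bar>(v /\<^sub>R norm v) $ j\<bar>" for j
    proof -
      have "norm v \<le> norm v ^ \<alpha> j" using v \<alpha>[of j] by (intro self_le_power) auto
      then have "\<bar>v $ j\<bar> / norm v ^ \<alpha> j \<le> \<bar>v $ j\<bar> / norm v"
        using v by (intro divide_left_mono mult_pos_pos) auto
      then show ?thesis using v
        by (simp add: weighted_scaling_def abs_mult power_divide divide_inverse mult.commute power_abs power_inverse)
    qed
    have "norm (weighted_scaling \<alpha> (1 / norm v) v) \<le> norm (v /\<^sub>R norm v)"
      by (rule norm_le_componentwise_cart) (use le in simp)
    also have "norm (v /\<^sub>R norm v) = 1" using v by (auto simp: field_simps)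
    finally show "norm (weighted_scaling \<alpha> (1 / norm v) v) \<le> 1" .
    show "continuous_on {1..norm v} (\<lambda>\<rho>. norm (weighted_scaling \<alpha> (1 / \<rho>) v))"
      unfolding weighted_scaling_def by (intro continuous_intros) auto
  qed (use v in auto)
  then obtain \<rho> where "1 \<le> \<rho>" "\<rho> \<le> norm v" "norm (weighted_scaling \<alpha> (1 / \<rho>) v) = 1" by blast
  then show ?thesis
    by (intro that[of \<rho> "weighted_scaling \<alpha> (1 / \<rho>) v"]) (auto simp: weighted_scaling_mult)
qed

abbreviation rescaled_field ::
    "(real^'n \<Rightarrow> real^'n) \<Rightarrow> ('n::finite \<Rightarrow> nat) \<Rightarrow> nat \<Rightarrow> 'n \<Rightarrow> real \<Rightarrow> real^'n \<Rightarrow> real^'n" where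
  "rescaled_field f \<alpha> k i \<sigma> w \<equiv> (\<chi> j. (w $ i) ^ (k + \<alpha> j) * f (compactification_inv \<alpha> i \<sigma> w) $ j)"

lemma norm_direction_lift_ge: "\<bar>\<sigma>\<bar> \<le> norm (direction_lift i \<sigma> w)"
  using component_le_norm_cart[of "direction_lift i \<sigma> w" i] by (simp add: direction_lift_def)

text \<open>With the lift of \<open>w\<close> written as \<open>\<theta>\<close> scaled by
  \<open>\<rho>\<close>, the inverse compactification is \<open>\<theta>\<close> scaled by
  \<open>\<rho> / s\<close>. Near the horizon this radius tends to infinity while
  \<open>\<rho>\<close> stays bounded, so the uniform limit on the sphere applies.\<close>

lemma rescaled_field_tendsto_horizon:
  fixes i :: "'n::finite"
  assumes \<alpha>: "\<And>j. 1 \<le> \<alpha> j" and \<sigma>: "\<sigma> \<in> {1, -1}" and h: "quasi_homogeneous \<alpha> k h"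
    and lim: "\<And>j. uniform_limit (sphere 0 1)
          (\<lambda>r x. inverse (r ^ (k + \<alpha> j)) *
                  (f (weighted_scaling \<alpha> r x) $ j - r ^ (k + \<alpha> j) * h x $ j))
          (\<lambda>x. 0) at_top"
    and z: "z $ i = 0"
  shows "(rescaled_field f \<alpha> k i \<sigma> \<longlongrightarrow> h (direction_lift i \<sigma> z)) (at z within {w. 0 < w $ i})"
proof (rule vec_tendstoI)
  fix j
  let ?e = "direction_lift i \<sigma>" and ?A = "at z within {w. 0 < w $ i}" and ?m = "k + \<alpha> j"
  define B where "B = norm (?e z) + 1"
  have B: "1 \<le> B" by (simp add: B_def)
  have e: "(?e \<longlongrightarrow> ?e z) ?A"
    using continuous_on_direction_lift[of UNIV i \<sigma>]
    by (auto simp: continuous_on_def intro: tendsto_within_subset)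
  have "((\<lambda>w. (w :: real^'n) $ i) \<longlongrightarrow> 0) ?A"
    using z by (auto intro!: tendsto_eq_intros)
  note small = order_tendstoD(2)[OF this]
  have bound: "eventually (\<lambda>w. norm (?e w) < B) ?A"
    by (rule order_tendstoD(2)[OF tendsto_norm[OF e]]) (simp add: B_def)
  have "((\<lambda>w. rescaled_field f \<alpha> k i \<sigma> w $ j - h (?e w) $ j) \<longlongrightarrow> 0) ?A"
  proof (rule tendstoI)
    fix \<eta> :: real assume \<eta>: "0 < \<eta>"
    \<comment> \<open>The factor \<open>\<rho> ^ ?m\<close> reappears on rescaling and is at most
      \<open>B ^ ?m\<close> near \<open>z\<close>.\<close>
    then have "0 < \<eta> / B ^ ?m" using B by simp
    from uniform_limitD[OF lim[of j] this] obtain r0 where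
      r0': "\<forall>r\<ge>r0. \<forall>x\<in>sphere 0 1. dist
        (inverse (r ^ ?m) * (f (weighted_scaling \<alpha> r x) $ j - r ^ ?m * h x $ j)) 0 < \<eta> / B ^ ?m"
      unfolding eventually_at_top_linorder by blast
    have r0: "\<bar>inverse (r ^ ?m) * (f (weighted_scaling \<alpha> r x) $ j - r ^ ?m * h x $ j)\<bar> < \<eta> / B ^ ?m"
      if "r0 \<le> r" "norm x = 1" for r x
      using r0'[rule_format, OF that(1), of x] that(2) by (simp only: dist_real_def diff_0_right mem_sphere_0)
    define R where "R = max r0 1"
    have R: "0 < R" "r0 \<le> R" by (auto simp: R_def)
    have "eventually (\<lambda>w. 0 < w $ i) ?A" by (simp add: eventually_at_filter)
    moreover have "eventually (\<lambda>w. w $ i < 1 / R) ?A" by (rule small) (use R in simp)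
    ultimately show "eventually (\<lambda>w. dist (rescaled_field f \<alpha> k i \<sigma> w $ j - h (?e w) $ j) 0 < \<eta>) ?A"
      using bound
    proof eventually_elim
      fix w assume w: "0 < w $ i" "w $ i < 1 / R" "norm (?e w) < B"
      have "1 \<le> norm (?e w)" using norm_direction_lift_ge[of \<sigma> i w] \<sigma> by auto
      with \<alpha> obtain \<rho> \<theta> where
        \<rho>: "1 \<le> \<rho>" "\<rho> \<le> norm (?e w)" "norm \<theta> = 1" "?e w = weighted_scaling \<alpha> \<rho> \<theta>"
        by (rule weighted_polar_decomposition)
      let ?r = "\<rho> / w $ i"
      let ?d = "inverse (?r ^ ?m) * (f (weighted_scaling \<alpha> ?r \<theta>) $ j - ?r ^ ?m * h \<theta> $ j)"
      have "R < 1 / w $ i" using w R by (simp add: field_simps)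
      also have "\<dots> \<le> ?r" using w \<rho> by (simp add: divide_right_mono)
      finally have "\<bar>?d\<bar> < \<eta> / B ^ ?m" using r0 \<rho> R by simp
      moreover have "\<rho> ^ ?m \<le> B ^ ?m" using \<rho> w by (intro power_mono) auto
      ultimately have "\<rho> ^ ?m * \<bar>?d\<bar> < B ^ ?m * (\<eta> / B ^ ?m)"
        using \<rho> B by (intro mult_le_less_imp_less) auto
      moreover have "h (?e w) $ j = \<rho> ^ ?m * h \<theta> $ j"
        using h unfolding quasi_homogeneous_def homogeneous_def \<rho>(4) by blast
      \<comment> \<open>Multiplying by \<open>\<rho> ^ ?m\<close> turns the inverse power of
        \<open>\<rho> / s\<close> into \<open>s ^ ?m\<close>, and homogeneity moves
        \<open>\<rho> ^ ?m\<close> inside \<open>h\<close>.\<close>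
      then have "rescaled_field f \<alpha> k i \<sigma> w $ j - h (?e w) $ j = \<rho> ^ ?m * ?d"
        using \<rho>(1) w(1)
        by (simp add: compactification_inv_eq_scaling \<rho>(4) weighted_scaling_mult power_divide)
          (simp add: field_simps)
      ultimately show "dist (rescaled_field f \<alpha> k i \<sigma> w $ j - h (?e w) $ j) 0 < \<eta>"
        using \<rho>(1) B by (simp add: abs_mult power_abs)
    qed
  qed
  moreover have "continuous_on UNIV h" using h smooth_imp_continuous_on unfolding quasi_homogeneous_def by blast
  then have "((\<lambda>w. h (?e w) $ j) \<longlongrightarrow> h (?e z) $ j) ?A"
    using e by (intro tendsto_vec_nth continuous_on_tendsto_compose[of UNIV h]) auto
  ultimately have "((\<lambda>w. rescaled_field f \<alpha> k i \<sigma> w $ j - h (?e w) $ j + h (?e w) $ j) \<longlongrightarrow> 0 + h (?e z) $ j) ?A"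
    by (rule tendsto_add)
  then show "((\<lambda>w. rescaled_field f \<alpha> k i \<sigma> w $ j) \<longlongrightarrow> h (?e z) $ j) ?A" by simp
qed

text \<open>Shifting along the \<open>i\<close>-th axis approaches \<open>z\<close> from the
  interior. Limits are then unique, which determines the value of \<open>Lim\<close> in
  \<open>f_hat\<close>.\<close>

lemma at_within_open_half_space_neq_bot:
  assumes "0 \<le> z $ i"
  shows "at z within {w :: real^'n. 0 < w $ i} \<noteq> bot"
proof -
  have "z islimpt {w. 0 < w $ i}"
    unfolding islimpt_approachable
  proof (intro allI impI)
    fix e :: real assume "0 < e"
    let ?w = "z + (e / 2) *\<^sub>R axis i 1"
    have "?w \<in> {w. 0 < w $ i}" "dist ?w z < e" using assms \<open>0 < e\<close> by (auto simp: dist_norm)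
    moreover have "?w \<noteq> z" using \<open>0 < e\<close> by (simp add: axis_eq_0_iff)
    ultimately show "\<exists>w\<in>{w. 0 < w $ i}. w \<noteq> z \<and> dist w z < e" by blast
  qed
  then show ?thesis by (simp add: trivial_limit_within)
qed

lemma f_hat_interior: "0 < z $ i \<Longrightarrow> f_hat f \<alpha> k i \<sigma> z = rescaled_field f \<alpha> k i \<sigma> z"
  by (simp add: f_hat_def)

lemma continuous_on_rescaled_field:
  assumes "smooth f"
  shows "continuous_on {w. 0 < w $ i} (rescaled_field f \<alpha> k i \<sigma>)"
proof -
  have "continuous_on {w. 0 < w $ i} (\<lambda>w. if j = i then \<sigma> / (w $ i) ^ \<alpha> i else w $ j / (w $ i) ^ \<alpha> j)" for j
    by (cases "j = i") (auto intro!: continuous_intros)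
  then have "continuous_on {w. 0 < w $ i} (compactification_inv \<alpha> i \<sigma>)"
    unfolding compactification_inv_def by (intro continuous_on_vec_lambda)
  then show ?thesis
    by (intro continuous_intros continuous_on_compose2[OF smooth_imp_continuous_on[OF assms, of UNIV]]) auto
qed

text \<open>The quasi-homogeneous part \<open>h\<close> gives the values on the horizon. Continuity
  there is tested from the interior, by the limit just computed, and along the horizon, by
  smoothness of \<open>h\<close>.\<close>

lemma f_hat_extension:
  fixes i :: "'n::finite"
  assumes \<alpha>: "\<And>j. 1 \<le> \<alpha> j" and \<sigma>: "\<sigma> \<in> {1, -1}" and f: "asymptotically_quasi_homogeneous \<alpha> k f"
  obtains h where "smooth h" "\<And>z. z \<in> horizon i \<Longrightarrow> f_hat f \<alpha> k i \<sigma> z = h (direction_lift i \<sigma> z)"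
    "continuous_on (phase_space i) (f_hat f \<alpha> k i \<sigma>)"
proof -
  let ?F = "rescaled_field f \<alpha> k i \<sigma>" and ?f = "f_hat f \<alpha> k i \<sigma>" and ?e = "direction_lift i \<sigma>"
  obtain h where h: "quasi_homogeneous \<alpha> k h"
    and lim: "\<And>j. uniform_limit (sphere 0 1)
          (\<lambda>r x. inverse (r ^ (k + \<alpha> j)) *
                  (f (weighted_scaling \<alpha> r x) $ j - r ^ (k + \<alpha> j) * h x $ j))
          (\<lambda>x. 0) at_top"
    using f unfolding asymptotically_quasi_homogeneous_def by blast
  have sm: "smooth f" "smooth h"
    using f h unfolding asymptotically_quasi_homogeneous_def quasi_homogeneous_def by auto
  have tend: "(?F \<longlongrightarrow> h (?e z)) (at z within {w. 0 < w $ i})" if "z \<in> horizon i" for z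
    using rescaled_field_tendsto_horizon[OF \<alpha> \<sigma> h lim] that by (auto simp: horizon_def)
  have hor: "?f z = h (?e z)" if "z \<in> horizon i" for z
  proof -
    have "z $ i = 0" using that by (simp add: horizon_def)
    then show ?thesis
      using tendsto_Lim[OF at_within_open_half_space_neq_bot tend[OF that]] by (simp add: f_hat_def)
  qed
  have "continuous (at z within phase_space i) ?f" if z: "z \<in> phase_space i" for z
  proof (cases "z $ i = 0")
    case False
    then have pos: "0 < z $ i" using z by (simp add: phase_space_def)
    have "continuous_on {w. 0 < w $ i} ?f"
      using continuous_on_rescaled_field[OF sm(1)]
      by (rule continuous_on_eq) (simp add: f_hat_interior)
    moreover have "open {w :: real^'n. 0 < w $ i}" by (intro open_Collect_less continuous_intros)
    ultimately show ?thesis using pos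
      by (metis continuous_on_eq_continuous_at continuous_at_imp_continuous_at_within mem_Collect_eq)
  next
    case True
    then have zh: "z \<in> horizon i" by (simp add: horizon_def)
    have "(?f \<longlongrightarrow> ?f z) (at z within {w. 0 < w $ i})"
      unfolding hor[OF zh]
      by (rule Lim_transform_eventually[OF tend[OF zh]]) (auto simp: eventually_at_filter f_hat_interior)
    moreover have "(?f \<longlongrightarrow> ?f z) (at z within horizon i)"
      unfolding hor[OF zh]
    proof (rule Lim_transform_eventually)
      have "continuous_on UNIV (\<lambda>w. h (?e w))"
        by (intro continuous_on_compose2[OF smooth_imp_continuous_on[OF sm(2), of UNIV]] continuous_on_direction_lift) auto
      then show "((\<lambda>w. h (?e w)) \<longlongrightarrow> h (?e z)) (at z within horizon i)"
        by (auto simp: continuous_on_def intro: tendsto_within_subset)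
      show "\<forall>\<^sub>F x in at z within horizon i. h (?e x) = ?f x"
        using hor by (auto simp: eventually_at_filter)
    qed
    moreover have "phase_space i = {w :: real^'n. 0 < w $ i} \<union> horizon i"
      by (auto simp: phase_space_def horizon_def)
    ultimately show ?thesis by (simp add: continuous_within Lim_within_Un)
  qed
  then have "continuous_on (phase_space i) ?f" by (simp add: continuous_on_eq_continuous_within)
  with sm(2) hor that show ?thesis by blast
qed

section \<open>Lipschitz continuity of the desingularized field\<close>

lemma lipschitzian_on_desingularized_field:
  assumes K: "compact K" and f: "lipschitzian_on K (f_hat f \<alpha> k i \<sigma>)"
  shows "lipschitzian_on K (desingularized_field f \<alpha> k i \<sigma>)"
proof (rule lipschitzian_on_vec)
  fix j
  \<comment> \<open>Each component is a polynomial in the coordinates of \<open>z\<close> and of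
    \<open>f_hat\<close>, so these closure rules reduce the claim to \<open>f_hat\<close>.\<close>
  note rules = lipschitzian_on_mult[OF K] lipschitzian_on_const lipschitzian_on_nth lipschitzian_on_vec_nth[OF f] lipschitzian_on_minus
  show "lipschitzian_on K (\<lambda>z. desingularized_field f \<alpha> k i \<sigma> z $ j)"
    unfolding desingularized_field_def
    by (cases "j = i") (simp_all only: vec_lambda_beta simp_thms if_True if_False, (intro rules)+)
qed

lemma lipschitzian_on_desingularized_field_interior:
  assumes f: "smooth f" and K: "compact K" and a: "0 < a" "\<And>z. z \<in> K \<Longrightarrow> a \<le> z $ i"
  shows "lipschitzian_on K (desingularized_field f \<alpha> k i \<sigma>)"
proof (rule lipschitzian_on_desingularized_field[OF K])
  have "lipschitzian_on K (compactification_inv \<alpha> i \<sigma>)"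
  proof (rule lipschitzian_on_vec)
    fix j
    have "lipschitzian_on K (\<lambda>z. inverse (z $ i) ^ \<alpha> j)"
      by (intro lipschitzian_on_power[OF K] lipschitzian_on_inverse[OF lipschitzian_on_nth a])
    note rules = lipschitzian_on_mult[OF K _ this] lipschitzian_on_const lipschitzian_on_nth
    have "lipschitzian_on K (\<lambda>z. \<sigma> * inverse (z $ i) ^ \<alpha> j)" "lipschitzian_on K (\<lambda>z. z $ j * inverse (z $ i) ^ \<alpha> j)"
      by (intro rules)+
    then show "lipschitzian_on K (\<lambda>z. compactification_inv \<alpha> i \<sigma> z $ j)"
      unfolding compactification_inv_def
      by (cases "j = i") (simp_all add: divide_inverse power_inverse)
  qed
  note fT = lipschitzian_on_smooth_compose[OF f K this]
  have "lipschitzian_on K (rescaled_field f \<alpha> k i \<sigma>)"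
  proof (rule lipschitzian_on_vec)
    show "lipschitzian_on K (\<lambda>z. rescaled_field f \<alpha> k i \<sigma> z $ j)" for j
      by (simp only: vec_lambda_beta) 
        (intro lipschitzian_on_mult[OF K] lipschitzian_on_power[OF K] lipschitzian_on_nth lipschitzian_on_vec_nth[OF fT])
  qed
  then show "lipschitzian_on K (f_hat f \<alpha> k i \<sigma>)"
    by (rule lipschitzian_on_cong) (use a in \<open>force simp: f_hat_interior\<close>)
qed

text \<open>Only points of the horizon are compared, and there \<open>f_hat\<close> is the smooth
  \<open>h\<close> composed with a Lipschitz map.\<close>

lemma lipschitzian_on_desingularized_field_horizon:
  assumes h: "smooth h" "\<And>z. z \<in> horizon i \<Longrightarrow> f_hat f \<alpha> k i \<sigma> z = h (direction_lift i \<sigma> z)"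
    and K: "compact K" "K \<subseteq> horizon i"
  shows "lipschitzian_on K (desingularized_field f \<alpha> k i \<sigma>)"
proof (rule lipschitzian_on_desingularized_field[OF K(1)])
  have "lipschitzian_on K (direction_lift i \<sigma>)"
  proof (rule lipschitzian_on_vec)
    show "lipschitzian_on K (\<lambda>z. direction_lift i \<sigma> z $ j)" for j
      unfolding direction_lift_def
      by (cases "j = i") (simp_all add: lipschitzian_on_const lipschitzian_on_nth)
  qed
  from lipschitzian_on_smooth_compose[OF h(1) K(1) this] show "lipschitzian_on K (f_hat f \<alpha> k i \<sigma>)"
    by (rule lipschitzian_on_cong) (use h K in auto)
qed

section \<open>Return to the original variables\<close>

lemma has_vector_derivative_vecI:
  fixes u :: "real \<Rightarrow> real^'n"
  assumes "\<And>j. ((\<lambda>t. u t $ j) has_vector_derivative u' $ j) (at t within X)"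
  shows "(u has_vector_derivative u') (at t within X)"
  unfolding has_vector_derivative_def
  by (subst has_derivative_componentwise_within)
    (use assms in \<open>auto simp: Basis_vec_def inner_axis has_vector_derivative_def\<close>)

text \<open>Chain rule for the change of variables: the desingularized field is \<open>f\<close> in
  the coordinates \<open>(s, x)\<close> multiplied by the speed \<open>s ^ k\<close> of physical
  time.\<close>

lemma compactification_inv_has_vector_derivative:
  assumes \<alpha>: "\<And>j. 1 \<le> \<alpha> j" and \<sigma>: "\<sigma> \<in> {1, -1}"
    and w: "(w has_vector_derivative desingularized_field f \<alpha> k i \<sigma> (w t)) (at t within X)"
    and pos: "0 < w t $ i"
  shows "((\<lambda>t. compactification_inv \<alpha> i \<sigma> (w t)) has_vector_derivative
      (w t $ i) ^ k *\<^sub>R f (compactification_inv \<alpha> i \<sigma> (w t))) (at t within X)"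
proof -
  let ?g = "desingularized_field f \<alpha> k i \<sigma>" and ?y = "compactification_inv \<alpha> i \<sigma> (w t)"
  let ?fh = "f_hat f \<alpha> k i \<sigma> (w t)"
  have ss: "\<sigma> * \<sigma> = 1" using \<sigma> by auto
  have ai: "real (\<alpha> i) \<noteq> 0" using \<alpha>[of i] by simp
  have d: "((\<lambda>t. w t $ j) has_real_derivative ?g (w t) $ j) (at t within X)" for j
    using bounded_linear.has_vector_derivative[OF bounded_linear_vec_nth w]
    by (simp add: has_real_derivative_iff_has_vector_derivative)
  have fh: "?fh $ j = (w t $ i) ^ (k + \<alpha> j) * f ?y $ j" for j
    using pos by (simp add: f_hat_interior)
  have pw: "(w t $ i) ^ \<alpha> j = w t $ i * (w t $ i) ^ (\<alpha> j - Suc 0)" for j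
    using \<alpha>[of j] by (metis One_nat_def Suc_le_lessD power_minus_mult mult.commute)
  have "((\<lambda>t. compactification_inv \<alpha> i \<sigma> (w t) $ j) has_real_derivative
      ((w t $ i) ^ k *\<^sub>R f ?y) $ j) (at t within X)" for j
  proof (cases "j = i")
    case True
    have "((\<lambda>t. \<sigma> / (w t $ i) ^ \<alpha> i) has_real_derivative
        - \<sigma> * (real (\<alpha> i) * (w t $ i) ^ (\<alpha> i - Suc 0) * ?g (w t) $ i) / ((w t $ i) ^ \<alpha> i * (w t $ i) ^ \<alpha> i)) (at t within X)"
      by (rule derivative_eq_intros d refl | use pos in simp)+
    moreover have "- \<sigma> * (real (\<alpha> i) * (w t $ i) ^ (\<alpha> i - Suc 0) * ?g (w t) $ i) / ((w t $ i) ^ \<alpha> i * (w t $ i) ^ \<alpha> i)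
        = (\<sigma> * \<sigma>) * ((w t $ i * (w t $ i) ^ (\<alpha> i - Suc 0)) * ?fh $ i) / ((w t $ i) ^ \<alpha> i * (w t $ i) ^ \<alpha> i)"
      using ai by (simp add: desingularized_field_def field_simps)
    moreover have "\<dots> = ((w t $ i) ^ k *\<^sub>R f ?y) $ i"
      unfolding ss pw[symmetric] fh using pos by (simp add: power_add)
    ultimately show ?thesis using True by (simp add: compactification_inv_def)
  next
    case False
    have "((\<lambda>t. w t $ j / (w t $ i) ^ \<alpha> j) has_real_derivative
        (?g (w t) $ j * (w t $ i) ^ \<alpha> j - w t $ j * (real (\<alpha> j) * (w t $ i) ^ (\<alpha> j - Suc 0) * ?g (w t) $ i)) /
          ((w t $ i) ^ \<alpha> j * (w t $ i) ^ \<alpha> j)) (at t within X)"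
      by (rule derivative_eq_intros d refl | use pos in simp)+
    \<comment> \<open>Differentiating the denominator produces exactly the term that compensates the
      correction in the \<open>j\<close>-th component of the field; only \<open>f_hat\<close>
      survives.\<close>
    moreover have "w t $ j * (real (\<alpha> j) * (w t $ i) ^ (\<alpha> j - Suc 0) * ?g (w t) $ i)
        = - (\<sigma> * real (\<alpha> j) / real (\<alpha> i) * w t $ j * ?fh $ i) * (w t $ i * (w t $ i) ^ (\<alpha> j - Suc 0))"
      using ai by (simp add: desingularized_field_def)
    then have "?g (w t) $ j * (w t $ i) ^ \<alpha> j - w t $ j * (real (\<alpha> j) * (w t $ i) ^ (\<alpha> j - Suc 0) * ?g (w t) $ i)
        = ?fh $ j * (w t $ i) ^ \<alpha> j"
      unfolding pw[symmetric] using False by (simp add: desingularized_field_def algebra_simps)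
    moreover have "?fh $ j * (w t $ i) ^ \<alpha> j / ((w t $ i) ^ \<alpha> j * (w t $ i) ^ \<alpha> j) = ((w t $ i) ^ k *\<^sub>R f ?y) $ j"
      unfolding fh using pos by (simp add: power_add)
    ultimately show ?thesis using False by (simp add: compactification_inv_def)
  qed
  then show ?thesis
    by (intro has_vector_derivative_vecI) (simp add: has_real_derivative_iff_has_vector_derivative)
qed

section \<open>Time change and blow-up\<close>

lemma strictly_increasing_time_change:
  fixes \<theta> d :: "real \<Rightarrow> real"
  assumes der: "\<And>\<tau>. 0 \<le> \<tau> \<Longrightarrow> (\<theta> has_real_derivative d \<tau>) (at \<tau> within {0..})"
    and pos: "\<And>\<tau>. 0 \<le> \<tau> \<Longrightarrow> 0 < d \<tau>"
    and "0 \<le> a" "a < b"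
  shows "\<theta> a < \<theta> b"
proof (rule DERIV_pos_imp_increasing_open[OF \<open>a < b\<close>])
  show "\<exists>y. DERIV \<theta> x :> y \<and> 0 < y" if "a < x" "x < b" for x
  proof -
    have "at x within {0..} = at x" using that \<open>0 \<le> a\<close> by (intro at_within_interior) simp
    then show ?thesis using der[of x] pos[of x] that \<open>0 \<le> a\<close> by auto
  qed
  have "continuous_on {0..} \<theta>" using der by (intro DERIV_continuous_on) auto
  then show "continuous_on {a..b} \<theta>" by (rule continuous_on_subset) (use \<open>0 \<le> a\<close> in auto)
qed

text \<open>Strict monotonicity makes \<open>\<theta>\<close> a bijection from the half-line onto
  \<open>{0..<T}\<close>. The difference quotients of the inverse are reciprocals of those of
  \<open>\<theta>\<close>, which covers the one-sided derivative at 0 too.\<close>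

lemma time_change_inverse:
  fixes \<theta> d :: "real \<Rightarrow> real"
  assumes \<theta>0: "\<theta> 0 = 0"
    and der: "\<And>\<tau>. 0 \<le> \<tau> \<Longrightarrow> (\<theta> has_real_derivative d \<tau>) (at \<tau> within {0..})"
    and pos: "\<And>\<tau>. 0 \<le> \<tau> \<Longrightarrow> 0 < d \<tau>"
    and lim: "(\<theta> \<longlongrightarrow> T) at_top"
  obtains \<eta> where "\<And>t. t \<in> {0..<T} \<Longrightarrow> 0 \<le> \<eta> t \<and> \<theta> (\<eta> t) = t"
    "\<And>\<tau>. 0 \<le> \<tau> \<Longrightarrow> \<theta> \<tau> \<in> {0..<T} \<and> \<eta> (\<theta> \<tau>) = \<tau>"
    "\<And>t. t \<in> {0..<T} \<Longrightarrow> (\<eta> has_real_derivative inverse (d (\<eta> t))) (at t within {0..<T})"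
proof -
  note mono = strictly_increasing_time_change[OF der pos]
  have mono': "a < b" if "0 \<le> a" "0 \<le> b" "\<theta> a < \<theta> b" for a b
    using mono[of b a] that by (cases a b rule: linorder_cases) auto
  have lt: "\<theta> \<tau> < T" if "0 \<le> \<tau>" for \<tau>
  proof -
    have "\<theta> (\<tau> + 1) \<le> T"
    proof (rule tendsto_lowerbound[OF lim])
      show "eventually (\<lambda>s. \<theta> (\<tau> + 1) \<le> \<theta> s) at_top"
        using eventually_gt_at_top[of "\<tau> + 1"] by eventually_elim (use mono that in \<open>force intro: less_imp_le\<close>)
    qed simp
    then show ?thesis using mono[of \<tau> "\<tau> + 1"] that by simp
  qed
  have ge: "0 \<le> \<theta> \<tau>" if "0 \<le> \<tau>" for \<tau>
    using mono[of 0 \<tau>] \<theta>0 that by (cases "\<tau> = 0") auto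
  have "\<exists>\<tau>\<ge>0. \<theta> \<tau> = t" if t: "t \<in> {0..<T}" for t
  proof -
    have "eventually (\<lambda>s. t < \<theta> s \<and> 0 \<le> s) at_top"
      using order_tendstoD(1)[OF lim, of t] eventually_ge_at_top[of 0] t by (intro eventually_conj) auto
    then obtain c where c: "t < \<theta> c" "0 \<le> c" using eventually_happens'[OF trivial_limit_at_top_linorder] by blast
    have "continuous_on {0..} \<theta>" using der by (intro DERIV_continuous_on) auto
    then have "continuous_on {0..c} \<theta>" by (rule continuous_on_subset) auto
    then have "\<exists>x\<ge>0. x \<le> c \<and> \<theta> x = t" using IVT'[of \<theta> 0 t c] c t \<theta>0 by auto
    then show ?thesis by blast
  qed
  then obtain \<eta> where \<eta>: "\<And>t. t \<in> {0..<T} \<Longrightarrow> 0 \<le> \<eta> t \<and> \<theta> (\<eta> t) = t" by metis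
  have \<eta>\<theta>: "\<theta> \<tau> \<in> {0..<T} \<and> \<eta> (\<theta> \<tau>) = \<tau>" if "0 \<le> \<tau>" for \<tau>
  proof -
    have *: "\<theta> \<tau> \<in> {0..<T}" using that lt ge by auto
    then show ?thesis using \<eta>[OF *] mono[of "\<eta> (\<theta> \<tau>)" \<tau>] mono[of \<tau> "\<eta> (\<theta> \<tau>)"] that
      by (cases "\<eta> (\<theta> \<tau>)" \<tau> rule: linorder_cases) auto
  qed
  have cont: "(\<eta> \<longlongrightarrow> \<eta> t) (at t within {0..<T})" if t: "t \<in> {0..<T}" for t
  proof (rule order_tendstoI)
    have mem: "eventually (\<lambda>u. u \<in> {0..<T}) (at t within {0..<T})" by (simp add: eventually_at_filter)
    have id: "((\<lambda>u. u) \<longlongrightarrow> t) (at t within {0..<T})" by (rule tendsto_ident_at)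
    fix a
    \<comment> \<open>Monotonicity of \<open>\<theta>\<close> is known only on nonnegative
      arguments; for negative \<open>a\<close> the claim follows from \<open>\<eta>\<close> being
      nonnegative.\<close>
    show "eventually (\<lambda>u. a < \<eta> u) (at t within {0..<T})" if a: "a < \<eta> t"
    proof (cases "a < 0")
      case True
      from mem show ?thesis by eventually_elim (use \<eta> True in force)
    next
      case False
      then have "\<theta> a < t" using mono[of a "\<eta> t"] \<eta>[OF t] a by auto
      from order_tendstoD(1)[OF id this] mem show ?thesis
        by eventually_elim (use mono' \<eta> False in force)
    qed
    show "eventually (\<lambda>u. \<eta> u < a) (at t within {0..<T})" if a: "\<eta> t < a"
    proof -
      have "t < \<theta> a" using mono[of "\<eta> t" a] \<eta>[OF t] a by auto
      from order_tendstoD(2)[OF id this] mem show ?thesis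
        by eventually_elim (use mono' \<eta> \<eta>[OF t] a in force)
    qed
  qed
  have "(\<eta> has_real_derivative inverse (d (\<eta> t))) (at t within {0..<T})" if t: "t \<in> {0..<T}" for t
    unfolding has_field_derivative_iff
  proof -
    have "filterlim \<eta> (at (\<eta> t) within {0..}) (at t within {0..<T})"
      unfolding filterlim_at
    proof (intro conjI cont t)
      have "\<eta> u \<in> {0..} \<and> \<eta> u \<noteq> \<eta> t" if "u \<in> {0..<T}" "u \<noteq> t" for u
        using \<eta>[OF that(1)] \<eta>[OF t] that by auto
      then show "\<forall>\<^sub>F u in at t within {0..<T}. \<eta> u \<in> {0..} \<and> \<eta> u \<noteq> \<eta> t"
        by (auto simp: eventually_at_filter)
    qed
    moreover have "((\<lambda>v. (\<theta> v - \<theta> (\<eta> t)) / (v - \<eta> t)) \<longlongrightarrow> d (\<eta> t)) (at (\<eta> t) within {0..})"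
      using der[of "\<eta> t"] \<eta>[OF t] unfolding has_field_derivative_iff by blast
    ultimately have "((\<lambda>u. (\<theta> (\<eta> u) - \<theta> (\<eta> t)) / (\<eta> u - \<eta> t)) \<longlongrightarrow> d (\<eta> t)) (at t within {0..<T})"
      by (rule filterlim_compose[rotated])
    then have "((\<lambda>u. inverse ((\<theta> (\<eta> u) - \<theta> (\<eta> t)) / (\<eta> u - \<eta> t))) \<longlongrightarrow> inverse (d (\<eta> t))) (at t within {0..<T})"
      using pos[of "\<eta> t"] \<eta>[OF t] by (intro tendsto_inverse) auto
    then show "((\<lambda>u. (\<eta> u - \<eta> t) / (u - t)) \<longlongrightarrow> inverse (d (\<eta> t))) (at t within {0..<T})"
      by (rule Lim_transform_eventually) (use \<eta> t in \<open>auto simp: eventually_at_filter\<close>)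
  qed
  with \<eta> \<eta>\<theta> that show ?thesis by blast
qed

text \<open>Both paths lie in a common ball, on which \<open>f\<close> is Lipschitz; Gronwall is
  applied to their squared distance, with rate \<open>2 * L\<close>.\<close>

lemma smooth_solution_unique:
  fixes f :: "'a::euclidean_space \<Rightarrow> 'a"
  assumes f: "smooth f" and u: "solves f UNIV {0..T} u" and v: "solves f UNIV {0..T} v"
    and "u 0 = v 0" and "0 \<le> T"
  shows "u T = v T"
proof -
  have "compact (u ` {0..T} \<union> v ` {0..T})"
    using solves_continuous_on[OF u] solves_continuous_on[OF v] by (intro compact_Un compact_continuous_image) auto
  then obtain R where "\<forall>x\<in>u ` {0..T} \<union> v ` {0..T}. norm x \<le> R" using compact_imp_bounded bounded_iff by blast
  then have R: "u t \<in> cball 0 R" "v t \<in> cball 0 R" if "t \<in> {0..T}" for t using that by auto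
  obtain L where L: "L-lipschitz_on (cball 0 R) f"
    using smooth_imp_lipschitzian_on[OF f compact_cball convex_cball] unfolding lipschitzian_on_def by blast
  let ?q = "\<lambda>t. (u t - v t) \<bullet> (u t - v t)"
  have "?q T \<le> ?q 0 * exp ((2 * L) * (T - 0))"
  proof (rule gronwall[where v = ?q, OF \<open>0 \<le> T\<close>])
    fix t assume t: "t \<in> {0..T}"
    have d: "((\<lambda>t. u t - v t) has_vector_derivative f (u t) - f (v t)) (at t within {0..T})"
      using u v t by (intro has_vector_derivative_diff) (auto simp: solves_def)
    from bounded_bilinear.has_vector_derivative[OF bounded_bilinear_inner d d]
    show "(?q has_real_derivative 2 * ((u t - v t) \<bullet> (f (u t) - f (v t)))) (at t within {0..T})"
      by (simp add: has_real_derivative_iff_has_vector_derivative inner_commute)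
    have "(u t - v t) \<bullet> (f (u t) - f (v t)) \<le> norm (u t - v t) * norm (f (u t) - f (v t))"
      by (rule norm_cauchy_schwarz)
    also have "\<dots> \<le> norm (u t - v t) * (L * norm (u t - v t))"
      using lipschitz_onD[OF L R(1)[OF t] R(2)[OF t]] by (intro mult_left_mono) (auto simp: dist_norm)
    finally show "2 * ((u t - v t) \<bullet> (f (u t) - f (v t))) \<le> 2 * L * ?q t"
      by (simp add: power2_norm_eq_inner[symmetric] power2_eq_square ac_simps)
  qed
  then have "?q T = 0" using \<open>u 0 = v 0\<close> inner_ge_zero[of "u T - v T"] by simp
  then show ?thesis by simp
qed

lemma physical_time_has_derivative:
  assumes "continuous_on {0..} w" "0 \<le> \<tau>"
  shows "(physical_time k i w has_real_derivative (w \<tau> $ i) ^ k) (at \<tau> within {0..})"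
proof -
  have "continuous_on {0..\<tau> + 1} (\<lambda>u. (w u $ i) ^ k)"
    using assms by (intro continuous_intros continuous_on_subset[OF assms(1)]) auto
  from integral_has_vector_derivative[OF this, of \<tau>] assms(2)
  show ?thesis
    unfolding physical_time_def[abs_def] at_within_Ici_eq_Icc[OF assms(2) less_add_one]
    by (simp add: has_real_derivative_iff_has_vector_derivative)
qed

section \<open>Blow-up in physical time\<close>

lemma physical_time_0 [simp]: "physical_time k i w 0 = 0"
  by (simp add: physical_time_def)

lemma bounded_increasing_tendsto_at_top:
  fixes \<theta> :: "real \<Rightarrow> real"
  assumes mono: "\<And>a b. 0 \<le> a \<Longrightarrow> a \<le> b \<Longrightarrow> \<theta> a \<le> \<theta> b" and bdd: "\<And>a. 0 \<le> a \<Longrightarrow> \<theta> a \<le> B"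
  obtains T where "(\<theta> \<longlongrightarrow> T) at_top"
proof
  have bd: "bdd_above (\<theta> ` {0..})" using bdd by (auto simp: bdd_above_def)
  show "(\<theta> \<longlongrightarrow> Sup (\<theta> ` {0..})) at_top"
  proof (rule order_tendstoI)
    fix a assume "a < Sup (\<theta> ` {0..})"
    then obtain t where t: "0 \<le> t" "a < \<theta> t" using less_cSup_iff[OF _ bd] by auto
    show "eventually (\<lambda>s. a < \<theta> s) at_top"
      using eventually_ge_at_top[of t] by eventually_elim (use t mono[of t] in force)
  next
    fix a assume a: "Sup (\<theta> ` {0..}) < a"
    have le: "\<theta> s \<le> Sup (\<theta> ` {0..})" if "0 \<le> s" for s
      using that by (intro cSup_upper[OF _ bd]) auto
    show "eventually (\<lambda>s. \<theta> s < a) at_top"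
      using eventually_ge_at_top[of 0] by eventually_elim (use le a in force)
  qed
qed

text \<open>Bounded increasing physical time has a limit \<open>T\<close>, and reparametrizing the
  inverse compactification of \<open>w\<close> gives a solution on \<open>{0..<T}\<close>. That no
  solution lives longer comes from uniqueness and the behaviour of the \<open>i\<close>-th
  component.\<close>

lemma blow_up_of_desingularized_solution:
  fixes f :: "real^'n \<Rightarrow> real^'n" and i :: "'n::finite"
  assumes \<alpha>: "\<And>j. 1 \<le> \<alpha> j" and \<sigma>: "\<sigma> \<in> {1, -1}" and f: "smooth f"
    and w: "solves (desingularized_field f \<alpha> k i \<sigma>) (phase_space i) {0..} w"
    and pos: "\<And>\<tau>. 0 \<le> \<tau> \<Longrightarrow> 0 < w \<tau> $ i"
    and lim0: "((\<lambda>\<tau>. w \<tau> $ i) \<longlongrightarrow> 0) at_top"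
    and bdd: "\<And>\<tau>. 0 \<le> \<tau> \<Longrightarrow> physical_time k i w \<tau> \<le> B"
  obtains y tmax where "blow_up_solution f (compactification_inv \<alpha> i \<sigma> (w 0)) y tmax"
    "\<And>\<tau>. 0 \<le> \<tau> \<Longrightarrow> physical_time k i w \<tau> < tmax \<and>
               y (physical_time k i w \<tau>) = compactification_inv \<alpha> i \<sigma> (w \<tau>)"
    "(physical_time k i w \<longlongrightarrow> tmax) at_top"
proof -
  let ?\<theta> = "physical_time k i w" and ?Y = "\<lambda>\<tau>. compactification_inv \<alpha> i \<sigma> (w \<tau>)"
  have der: "(?\<theta> has_real_derivative (w \<tau> $ i) ^ k) (at \<tau> within {0..})" if "0 \<le> \<tau>" for \<tau>
    using physical_time_has_derivative[OF solves_continuous_on[OF w] that] .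
  have pos': "0 < (w \<tau> $ i) ^ k" if "0 \<le> \<tau>" for \<tau> using pos[OF that] by simp
  note mono = strictly_increasing_time_change[OF der pos']
  have "?\<theta> a \<le> ?\<theta> c" if "0 \<le> a" "a \<le> c" for a c using mono[of a c] that by (cases "a = c") auto
  then obtain T where T: "(?\<theta> \<longlongrightarrow> T) at_top" using bounded_increasing_tendsto_at_top[of ?\<theta> B] bdd by blast
  obtain \<eta> where \<eta>: "\<And>t. t \<in> {0..<T} \<Longrightarrow> 0 \<le> \<eta> t \<and> ?\<theta> (\<eta> t) = t"
    "\<And>\<tau>. 0 \<le> \<tau> \<Longrightarrow> ?\<theta> \<tau> \<in> {0..<T} \<and> \<eta> (?\<theta> \<tau>) = \<tau>"
    "\<And>t. t \<in> {0..<T} \<Longrightarrow> (\<eta> has_real_derivative inverse ((w (\<eta> t) $ i) ^ k)) (at t within {0..<T})"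
    using time_change_inverse[OF physical_time_0 der pos' T] by blast
  define y where "y t = ?Y (\<eta> t)" for t
  have y\<theta>: "y (?\<theta> \<tau>) = ?Y \<tau>" if "0 \<le> \<tau>" for \<tau> using \<eta>(2)[OF that] by (simp add: y_def)
  have y0: "y 0 = ?Y 0" using y\<theta>[of 0] by simp
  have T0: "0 < T" using \<eta>(2)[of 0] by simp
  have sol: "solves f UNIV {0..<T} y"
    unfolding solves_def
  proof (intro ballI conjI UNIV_I)
    fix t assume t: "t \<in> {0..<T}"
    have \<eta>t: "0 \<le> \<eta> t" using \<eta>(1)[OF t] by simp
    have "(?Y has_vector_derivative (w (\<eta> t) $ i) ^ k *\<^sub>R f (?Y (\<eta> t))) (at (\<eta> t) within {0..})"
      using w \<eta>t by (intro compactification_inv_has_vector_derivative \<alpha> \<sigma> pos) (auto simp: solves_def)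
    then have "(?Y has_vector_derivative (w (\<eta> t) $ i) ^ k *\<^sub>R f (?Y (\<eta> t))) (at (\<eta> t) within \<eta> ` {0..<T})"
      by (rule has_vector_derivative_within_subset) (use \<eta>(1) in auto)
    from vector_diff_chain_within[OF \<eta>(3)[OF t, unfolded has_real_derivative_iff_has_vector_derivative] this]
    show "(y has_vector_derivative f (y t)) (at t within {0..<T})"
      using pos[OF \<eta>t] by (simp add: y_def[abs_def] o_def left_inverse)
  qed
  have "T' \<le> T" if T': "0 < T'" "v 0 = ?Y 0" "solves f UNIV {0..<T'} v" for T' v
  proof (rule ccontr)
    assume "\<not> T' \<le> T"
    then have TT': "T < T'" by simp
    have eq: "v (?\<theta> \<tau>) = ?Y \<tau>" if "0 \<le> \<tau>" for \<tau>
    proof -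
      have \<theta>\<tau>: "?\<theta> \<tau> \<in> {0..<T}" using \<eta>(2)[OF that] by simp
      have "solves f UNIV {0..?\<theta> \<tau>} v"
        by (rule solves_subset[OF T'(3)]) (use \<theta>\<tau> TT' in auto)
      moreover have "solves f UNIV {0..?\<theta> \<tau>} y"
        by (rule solves_subset[OF sol]) (use \<theta>\<tau> in auto)
      ultimately have "v (?\<theta> \<tau>) = y (?\<theta> \<tau>)"
        by (rule smooth_solution_unique[OF f]) (use T'(2) y0 \<theta>\<tau> in auto)
      then show ?thesis using y\<theta>[OF that] by simp
    qed
    have "(v \<longlongrightarrow> v T) (at T within {0..<T'})"
      using solves_continuous_on[OF T'(3)] T0 TT' by (auto simp: continuous_on_def)
    moreover have "filterlim ?\<theta> (at T within {0..<T'}) at_top"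
      unfolding filterlim_at
    proof (intro conjI T)
      have *: "?\<theta> \<tau> \<in> {0..<T'} \<and> ?\<theta> \<tau> \<noteq> T" if "0 \<le> \<tau>" for \<tau> using \<eta>(2)[OF that] TT' by auto
      show "\<forall>\<^sub>F \<tau> in at_top. ?\<theta> \<tau> \<in> {0..<T'} \<and> ?\<theta> \<tau> \<noteq> T"
        by (rule eventually_mono[OF eventually_ge_at_top[of 0] *])
    qed
    ultimately have "((\<lambda>\<tau>. v (?\<theta> \<tau>)) \<longlongrightarrow> v T) at_top" by (rule filterlim_compose)
    \<comment> \<open>A solution continued past \<open>T\<close> would have a finite limit here,
      forcing the product to 0, whereas along \<open>w\<close> it is constantly
      \<open>\<sigma>\<close>.\<close>
    then have "((\<lambda>\<tau>. v (?\<theta> \<tau>) $ i * (w \<tau> $ i) ^ \<alpha> i) \<longlongrightarrow> v T $ i * 0 ^ \<alpha> i) at_top"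
      by (intro tendsto_intros lim0)
    moreover have "v T $ i * 0 ^ \<alpha> i = 0" using \<alpha>[of i] by simp
    moreover have "\<forall>\<^sub>F \<tau> in at_top. v (?\<theta> \<tau>) $ i * (w \<tau> $ i) ^ \<alpha> i = \<sigma>"
      using eventually_ge_at_top[of 0]
    proof eventually_elim
      fix \<tau> :: real assume "0 \<le> \<tau>"
      then show "v (?\<theta> \<tau>) $ i * (w \<tau> $ i) ^ \<alpha> i = \<sigma>"
        using pos[of \<tau>] by (simp add: eq compactification_inv_def)
    qed
    ultimately have "((\<lambda>\<tau>. \<sigma>) \<longlongrightarrow> 0) (at_top :: real filter)"
      using Lim_transform_eventually by fastforce
    then have "\<sigma> = 0" using tendsto_unique[OF trivial_limit_at_top_linorder _ tendsto_const] by metis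
    then show False using \<sigma> by auto
  qed
  note upper = this
  have "max_existence_time f (?Y 0) = ereal T"
    unfolding max_existence_time_def
  proof (rule Sup_eqI)
    let ?E = "{T. 0 < T \<and> (\<exists>v. v 0 = ?Y 0 \<and> solves f UNIV {0..<T} v)}"
    show "r \<le> ereal T" if "r \<in> ereal ` ?E" for r using that upper by auto
    \<comment> \<open>The supremum is attained by the solution constructed above.\<close>
    have "T \<in> ?E" using sol y0 T0 by blast
    then show "ereal T \<le> r" if "\<And>x. x \<in> ereal ` ?E \<Longrightarrow> x \<le> r" for r using that by blast
  qed
  then have "blow_up_solution f (?Y 0) y T" using sol y0 by (simp add: blow_up_solution_def)
  then show ?thesis using that T y\<theta> \<eta>(2) by force
qed

text \<open>Gronwall gives exponential decay of \<open>V\<close>, and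
  \<open>s\<^sup>2 <= c1 * V\<close> passes it on to \<open>s ^ k\<close>; integrating this majorant
  over all times after \<open>\<tau>0\<close> gives the bound.\<close>

lemma physical_time_le_integrated_time_bound:
  fixes w :: "real \<Rightarrow> real^'n" and i :: "'n::finite"
  assumes k: "1 \<le> k" and c: "0 < c1" "0 < c" and \<tau>: "0 \<le> \<tau>0" "\<tau>0 \<le> \<tau>"
    and w: "continuous_on {0..} w"
    and V: "\<And>t. t \<in> {\<tau>0..\<tau>} \<Longrightarrow> (V has_real_derivative V' t) (at t within {\<tau>0..\<tau>})"
      "\<And>t. t \<in> {\<tau>0..\<tau>} \<Longrightarrow> V' t \<le> - c * c1 * V t" "V \<tau>0 \<le> \<epsilon>"
    and s: "\<And>t. t \<in> {\<tau>0..\<tau>} \<Longrightarrow> 0 \<le> w t $ i" "\<And>t. t \<in> {\<tau>0..\<tau>} \<Longrightarrow> (w t $ i)\<^sup>2 \<le> c1 * V t"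
  shows "physical_time k i w \<tau> \<le> physical_time k i w \<tau>0 + integrated_time_bound k c1 c \<epsilon>"
proof -
  define A where "A = sqrt ((c1 * \<epsilon>) ^ k)"
  \<comment> \<open>\<open>V\<close> decays at rate \<open>c * c1\<close>, so its power
    \<open>k / 2\<close> decays at rate \<open>\<gamma>\<close>, and \<open>A / \<gamma>\<close> is
    the full integral of the majorant.\<close>
  define \<gamma> where "\<gamma> = real k * c * c1 / 2"
  have \<gamma>: "0 < \<gamma>" using k c by (simp add: \<gamma>_def)
  have "0 \<le> c1 * V \<tau>0" using s(2)[of \<tau>0] \<tau> by (meson atLeastAtMost_iff order_refl order_trans zero_le_power2)
  then have \<epsilon>: "0 \<le> \<epsilon>" using c V(3) by (simp add: zero_le_mult_iff)
  have decay: "(w t $ i) ^ k \<le> A * exp (- \<gamma> * (t - \<tau>0))" if t: "t \<in> {\<tau>0..\<tau>}" for t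
  proof -
    have "V t \<le> V \<tau>0 * exp ((- c * c1) * (t - \<tau>0))"
    proof (rule gronwall)
      show "(V has_real_derivative V' r) (at r within {\<tau>0..t})" if "r \<in> {\<tau>0..t}" for r
        by (rule DERIV_subset[OF V(1)]) (use that t in auto)
    qed (use V t in auto)
    also have "\<dots> \<le> \<epsilon> * exp ((- c * c1) * (t - \<tau>0))" using V(3) by (intro mult_right_mono) auto
    finally have "(w t $ i)\<^sup>2 \<le> c1 * (\<epsilon> * exp ((- c * c1) * (t - \<tau>0)))"
      using s(2)[OF t] c by (meson mult_left_mono less_imp_le order_trans)
    then have "((w t $ i)\<^sup>2) ^ k \<le> (c1 * (\<epsilon> * exp ((- c * c1) * (t - \<tau>0)))) ^ k"
      by (intro power_mono) auto
    also have "\<dots> = (c1 * \<epsilon>) ^ k * exp (real k * ((- c * c1) * (t - \<tau>0)))"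
      by (simp only: exp_of_nat_mult power_mult_distrib mult.assoc)
    also have "\<dots> = (A * exp (- \<gamma> * (t - \<tau>0)))\<^sup>2"
    proof -
      have "A\<^sup>2 = (c1 * \<epsilon>) ^ k" using c \<epsilon> by (simp add: A_def)
      moreover have "(exp (- \<gamma> * (t - \<tau>0)))\<^sup>2 = exp (real k * ((- c * c1) * (t - \<tau>0)))"
      proof -
        have "2 * (- \<gamma> * (t - \<tau>0)) = real k * ((- c * c1) * (t - \<tau>0))" by (simp add: \<gamma>_def)
        then show ?thesis by (metis exp_double)
      qed
      ultimately show ?thesis by (simp add: power_mult_distrib)
    qed
    finally have "((w t $ i) ^ k)\<^sup>2 \<le> (A * exp (- \<gamma> * (t - \<tau>0)))\<^sup>2"
      by (simp only: power_mult[symmetric] mult.commute[of 2 k])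
    then show ?thesis
      by (rule power2_le_imp_le) (use c \<epsilon> in \<open>simp add: A_def\<close>)
  qed
  \<comment> \<open>Physical time minus the integral of the majorant from \<open>\<tau>0\<close>;
    its derivative is nonpositive by \<open>decay\<close>.\<close>
  let ?q = "\<lambda>t. physical_time k i w t - A / \<gamma> + A / \<gamma> * exp (- \<gamma> * (t - \<tau>0))"
  have "?q \<tau> + A / \<gamma> \<le> ?q \<tau>0 + A / \<gamma>"
  proof (rule add_right_mono, rule DERIV_nonpos_imp_decreasing_within[where v = ?q, OF \<tau>(2)])
    fix t assume t: "t \<in> {\<tau>0..\<tau>}"
    have d: "(physical_time k i w has_real_derivative (w t $ i) ^ k) (at t within {\<tau>0..\<tau>})"
      by (rule DERIV_subset[OF physical_time_has_derivative[OF w]]) (use t \<tau> in auto)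
    show "(?q has_real_derivative (w t $ i) ^ k - A * exp (- \<gamma> * (t - \<tau>0))) (at t within {\<tau>0..\<tau>})"
      using \<gamma> by (auto intro!: derivative_eq_intros d)
    show "(w t $ i) ^ k - A * exp (- \<gamma> * (t - \<tau>0)) \<le> 0" using decay[OF t] by simp
  qed
  moreover have "0 \<le> A / \<gamma> * exp (- \<gamma> * (\<tau> - \<tau>0))"
    using \<gamma> c \<epsilon> by (simp add: A_def)
  moreover have "A / \<gamma> = integrated_time_bound k c1 c \<epsilon>"
    by (simp add: A_def \<gamma>_def integrated_time_bound_def)
  ultimately show ?thesis by simp
qed

text \<open>The quotient of the two bounds is \<open>sqrt (c1 ^ (k - 1)) / k\<close>.\<close>

lemma integrated_time_bound_le_blow_up_time_bound:
  assumes k: "1 \<le> k" and c: "0 < c1" "0 < c" and \<epsilon>: "0 < \<epsilon>" and le: "c1 ^ (k - 1) \<le> (real k)\<^sup>2"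
  shows "integrated_time_bound k c1 c \<epsilon> \<le> blow_up_time_bound k c1 c \<epsilon>"
proof -
  have "sqrt (c1 ^ (k - 1)) \<le> real k" using le by (simp add: real_le_lsqrt)
  moreover have "c1 ^ k = c1 ^ (k - 1) * c1" using k by (metis power_minus_mult less_le_trans zero_less_one)
  ultimately have "sqrt (c1 ^ k) \<le> real k * sqrt c1" using c by (simp add: real_sqrt_mult mult_right_mono)
  then have "sqrt (c1 ^ k) * sqrt (\<epsilon> ^ k) / (real k * c1) \<le> real k * sqrt c1 * sqrt (\<epsilon> ^ k) / (real k * c1)"
    using k c \<epsilon> by (intro divide_right_mono mult_right_mono) auto
  also have "\<dots> = sqrt (\<epsilon> ^ k) / sqrt c1"
    using k c by (simp add: field_simps)
  finally have "2 / c * (sqrt (c1 ^ k) * sqrt (\<epsilon> ^ k) / (real k * c1)) \<le> 2 / c * (sqrt (\<epsilon> ^ k) / sqrt c1)"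
    using c by (intro mult_left_mono) auto
  then show ?thesis
    unfolding integrated_time_bound_def blow_up_time_bound_def
    by (simp add: real_sqrt_mult real_sqrt_divide power_mult_distrib ac_simps)
qed

text \<open>The equation is autonomous, so \<open>u\<close> may be shifted. At the junction the
  derivatives from both sides equal \<open>g (z a)\<close> and combine into a two-sided one.\<close>

lemma solves_concat:
  assumes z: "solves g S {0..a} z" and u: "solves g S {0..} u" and eq: "u 0 = z a" and a: "0 \<le> a"
  shows "solves g S {0..} (\<lambda>t. if t \<le> a then z t else u (t - a))"
    (is "solves g S _ ?w")
  unfolding solves_def
proof (intro ballI conjI)
  fix t :: real assume t: "t \<in> {0..}"
  show "?w t \<in> S" using z u t by (auto simp: solves_def)
  have wu: "?w r = u (r - a)" if "r \<in> {a..}" for r using that eq by auto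
  have left: "(?w has_vector_derivative g (?w t)) (at t within {0..a})" if "t \<le> a"
  proof -
    have "(z has_vector_derivative g (z t)) (at t within {0..a})" using z t that by (auto simp: solves_def)
    then have "(?w has_vector_derivative g (z t)) (at t within {0..a})"
      by (rule has_vector_derivative_transform[rotated 2]) (use t that in auto)
    then show ?thesis using that by simp
  qed
  have right: "(?w has_vector_derivative g (?w t)) (at t within {a..})" if "a \<le> t"
  proof -
    have "(u has_vector_derivative g (u (t - a))) (at (t - a) within {0..})"
      using u that by (auto simp: solves_def)
    then have "(u has_vector_derivative g (u (t - a))) (at (t - a) within (\<lambda>t. t - a) ` {a..})"
      by (rule has_vector_derivative_within_subset) auto
    then have "(u \<circ> (\<lambda>t. t - a) has_vector_derivative 1 *\<^sub>R g (u (t - a))) (at t within {a..})"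
      by (intro vector_diff_chain_within) (auto intro!: derivative_eq_intros)
    then have "((\<lambda>t. u (t - a)) has_vector_derivative g (?w t)) (at t within {a..})"
      using wu[of t] that by (simp add: o_def)
    then show ?thesis
      by (rule has_vector_derivative_transform[rotated 2]) (use wu that in auto)
  qed
  consider "t < a" | "t = a" | "a < t" by linarith
  then show "(?w has_vector_derivative g (?w t)) (at t within {0..})"
  proof cases
    case 1
    then show ?thesis using left at_within_Ici_eq_Icc[of 0 t a] t by simp
  next
    case 2
    have "{0..} = {0..a} \<union> {a..}" using a by auto
    then show ?thesis using left right 2
      unfolding has_vector_derivative_def has_derivative_within by (simp add: Lim_within_Un)
  next
    case 3
    have "at t within {0..} = at t within {a..}"
      by (rule at_within_nhd[where S = "{a<..}"]) (use 3 t a in auto)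
    then show ?thesis using right 3 by simp
  qed
qed

text \<open>The constants \<open>c1\<close> and \<open>c\<close> are quantified last, since
  \<open>w\<close>, \<open>y\<close> and \<open>tmax\<close> do not depend on them. The interval
  with \<open>integrated_time_bound\<close> holds for every \<open>k\<close>; the one with
  \<open>blow_up_time_bound\<close> carries the condition under which it is the weaker bound, which
  is automatic for \<open>k = 1\<close>.\<close>

theorem theorem4p5:
  fixes f :: "real^'n \<Rightarrow> real^'n"
    and \<alpha> :: "'n::finite \<Rightarrow> nat" and k :: nat and i :: 'n and \<sigma> :: real
    and y0 zstar :: "real^'n"
    and Nt :: "(real^'n) set" and Y :: "real^'n^'n" and \<epsilon> :: real
    and \<tau>N :: real and z :: "real \<Rightarrow> real^'n"
  assumes weights: "\<And>j. 1 \<le> \<alpha> j" and k: "1 \<le> k" and sign: "\<sigma> \<in> {1, -1}"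
    and f: "smooth f" "asymptotically_quasi_homogeneous \<alpha> k f"
    and y0: "0 < \<sigma> * y0 $ i"
    and equilibrium: "zstar \<in> horizon i" "desingularized_field f \<alpha> k i \<sigma> zstar = 0"
    and Nt: "compact Nt" "starlike Nt" "Nt \<subseteq> phase_space i" "zstar \<in> Nt"
    and Y: "positive_definite Y"
    and A: "\<And>p. p \<in> Nt \<Longrightarrow>
          desingularized_field f \<alpha> k i \<sigma> differentiable (at p within phase_space i) \<and>
          negative_definite
            (lyapunov_matrix (desingularized_field f \<alpha> k i \<sigma>) (phase_space i) Y p)"
    and \<epsilon>: "0 < \<epsilon>" "sublevel i Y zstar \<epsilon> \<subseteq> Nt"
      "\<And>\<epsilon>'. sublevel i Y zstar \<epsilon>' \<subseteq> Nt \<Longrightarrow> \<epsilon>' \<le> \<epsilon>"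
    and z: "0 < \<tau>N" "z 0 = compactification \<alpha> i \<sigma> y0"
      "solves (desingularized_field f \<alpha> k i \<sigma>) (phase_space i) {0..\<tau>N} z"
      "lyapunov_function Y zstar (z \<tau>N) < \<epsilon>"
  shows "asymptotically_stable (desingularized_field f \<alpha> k i \<sigma>) (phase_space i) zstar \<and>
    (\<exists>w y tmax.
       solves (desingularized_field f \<alpha> k i \<sigma>) (phase_space i) {0..} w \<and>
       (\<forall>\<tau>\<in>{0..\<tau>N}. w \<tau> = z \<tau>) \<and>
       (\<forall>\<tau>\<ge>0. 0 < w \<tau> $ i) \<and>
       (w \<longlongrightarrow> zstar) at_top \<and>
       blow_up_solution f y0 y tmax \<and>
       (\<forall>\<tau>\<ge>0. physical_time k i w \<tau> < tmax \<and>
               y (physical_time k i w \<tau>) = compactification_inv \<alpha> i \<sigma> (w \<tau>)) \<and>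
       (physical_time k i w \<longlongrightarrow> tmax) at_top \<and>
       (\<forall>c1 c. lyapunov_constants (desingularized_field f \<alpha> k i \<sigma>) Nt Y zstar c1 c \<longrightarrow>
          tmax \<in> {physical_time k i z \<tau>N ..
                   physical_time k i z \<tau>N + integrated_time_bound k c1 c \<epsilon>} \<and>
          (c1 ^ (k - 1) \<le> (real k)\<^sup>2 \<longrightarrow>
             tmax \<in> {physical_time k i z \<tau>N ..
                      physical_time k i z \<tau>N + blow_up_time_bound k c1 c \<epsilon>})))"
proof -
  let ?g = "desingularized_field f \<alpha> k i \<sigma>" and ?H = "phase_space i" and ?L = "lyapunov_function Y zstar"
  let ?\<theta> = "physical_time k i" and ?N = "sublevel i Y zstar \<epsilon>"
  obtain h where h: "smooth h" "\<And>z. z \<in> horizon i \<Longrightarrow> f_hat f \<alpha> k i \<sigma> z = h (direction_lift i \<sigma> z)"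
    "continuous_on ?H (f_hat f \<alpha> k i \<sigma>)"
    using f_hat_extension[OF weights sign f(2)] by blast
  note eps = \<epsilon>
  \<comment> \<open>The cofactor \<open>b\<close> is read off from the equation for
    \<open>s\<close>, which carries an explicit factor \<open>s\<close>.\<close>
  interpret lyapunov_basin ?g i Y zstar \<epsilon> "\<lambda>z. - (\<sigma> / real (\<alpha> i)) * f_hat f \<alpha> k i \<sigma> z $ i"
  proof
    show "zstar $ i = 0" using equilibrium by (simp add: horizon_def)
    show "?g differentiable (at z within ?H)" "negative_definite (lyapunov_matrix ?g ?H Y z)"
      if "z \<in> ?N" for z using A[of z] eps(2) that by auto
    show "lipschitzian_on K ?g" if "compact K" "0 < a" "K \<subseteq> {z. a \<le> z $ i}" for K a
      by (rule lipschitzian_on_desingularized_field_interior[OF f(1) that(1,2)]) (use that in auto)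
    show "lipschitzian_on K ?g" if "compact K" "K \<subseteq> horizon i" for K
      by (rule lipschitzian_on_desingularized_field_horizon[OF h(1,2) that])
    show "?g z $ i = z $ i * (- (\<sigma> / real (\<alpha> i)) * f_hat f \<alpha> k i \<sigma> z $ i)" for z
      by (simp add: desingularized_field_def)
    show "continuous_on ?H (\<lambda>z. - (\<sigma> / real (\<alpha> i)) * f_hat f \<alpha> k i \<sigma> z $ i)"
      by (intro continuous_intros h(3))
  qed (use Y eps equilibrium in auto)
  \<comment> \<open>Membership in the image turns the inverse function into a true preimage, with
    positive first coordinate \<open>s\<close>.\<close>
  have "y0 \<in> compactification_inv \<alpha> i \<sigma> ` {z. 0 < z $ i}"
    using bij_betw_compactification_inv[of \<alpha> \<sigma> i, OF weights sign] y0 by (simp add: bij_betw_def)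
  then have Tz0: "compactification_inv \<alpha> i \<sigma> (z 0) = y0" "0 < z 0 $ i"
    using f_inv_into_f[of y0 "compactification_inv \<alpha> i \<sigma>" "{z. 0 < z $ i}"]
      inv_into_into[of y0 "compactification_inv \<alpha> i \<sigma>" "{z. 0 < z $ i}"]
    unfolding z(2) compactification_def by simp_all
  have zpos: "0 < z t $ i" if "t \<in> {0..\<tau>N}" for t
    using component_positive[OF z(3) Tz0(2) that] .
  have zN: "z \<tau>N \<in> ?H" using z by (auto simp: solves_def)
  obtain u where u: "u 0 = z \<tau>N" "solves ?g ?N {0..} u" "0 < z \<tau>N $ i \<Longrightarrow> \<forall>t\<ge>0. 0 < u t $ i"
    using global_existence[OF zN z(4)] by blast
  have upos: "0 < u t $ i" if "0 \<le> t" for t using u(3) zpos[of \<tau>N] z(1) that by simp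
  \<comment> \<open>The validated solution up to \<open>\<tau>N\<close>, continued by the basin
    solution that starts at \<open>z \<tau>N\<close>.\<close>
  define w where "w t = (if t \<le> \<tau>N then z t else u (t - \<tau>N))" for t
  have w: "solves ?g ?H {0..} w"
    unfolding w_def[abs_def]
    using z(1) by (intro solves_concat z(3) u(1) solves_subset[OF u(2) subset_refl N_subset_H]) auto
  have wz: "\<forall>\<tau>\<in>{0..\<tau>N}. w \<tau> = z \<tau>" by (simp add: w_def)
  have wu: "w \<tau> = u (\<tau> - \<tau>N)" if "\<tau>N \<le> \<tau>" for \<tau>
    using that u(1) by (cases "\<tau> = \<tau>N") (auto simp: w_def)
  have wpos: "0 < w \<tau> $ i" if "0 \<le> \<tau>" for \<tau>
    using that zpos upos by (auto simp: w_def)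
  have wN: "w \<tau> \<in> ?N" if "\<tau>N \<le> \<tau>" for \<tau>
    using that u(2) by (auto simp: wu solves_def)
  have "filterlim (\<lambda>t. t - \<tau>N) at_top at_top"
    using filterlim_tendsto_add_at_top[OF tendsto_const[of "- \<tau>N"] filterlim_ident] by simp
  from filterlim_compose[OF attraction[OF u(2)] this]
  have wlim: "(w \<longlongrightarrow> zstar) at_top"
    by (rule Lim_transform_eventually)
      (rule eventually_mono[OF eventually_ge_at_top[of \<tau>N]], simp add: wu)
  have w_cont: "continuous_on {0..} w" by (rule solves_continuous_on[OF w])
  have wder: "((\<lambda>t. ?L (w t)) has_real_derivative 2 * ((w t - zstar) \<bullet> (Y *v ?g (w t)))) (at t within {a..b})"
    if "0 \<le> a" "t \<in> {a..b}" for a b t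
    using solves_subset[OF w, of "{a..b}" ?H] that by (intro L_has_derivative) (auto simp: solves_def)
  \<comment> \<open>The equilibrium lies on the horizon, so \<open>s\<close> is a component of the
    difference from it.\<close>
  have wsq: "(w t $ i)\<^sup>2 \<le> (norm (w t - zstar))\<^sup>2" for t
    using component_le_norm_cart[of "w t - zstar" i] p(1) by (simp add: abs_le_square_iff[symmetric])
  have \<theta>_mono: "?\<theta> w a \<le> ?\<theta> w b" if "0 \<le> a" "a \<le> b" for a b
    using strictly_increasing_time_change[OF physical_time_has_derivative[OF w_cont], of i k a b] wpos that
    by (cases "a = b") auto
  \<comment> \<open>These local constants serve only to bound physical time, and so to show blow-up;
    the constants of the conclusion enter later and need not exist for this.\<close>
  obtain r c1 c where rc: "0 < r" "r \<le> \<epsilon>" "0 < c1" "0 < c"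
    "\<And>z. (norm (z - zstar))\<^sup>2 \<le> c1 * ?L z"
    "\<And>z. z \<in> sublevel i Y zstar r \<Longrightarrow> 2 * ((z - zstar) \<bullet> (Y *v ?g z)) \<le> - c * c1 * ?L z"
    using local_exponential_decay by blast
  obtain d where d: "0 < d" "\<And>z. dist z zstar < d \<Longrightarrow> ?L z < r" using nbhd_sublevel[OF rc(1)] by metis
  obtain \<tau>0 where \<tau>0: "0 \<le> \<tau>0" "\<And>\<tau>. \<tau>0 \<le> \<tau> \<Longrightarrow> dist (w \<tau>) zstar < d"
  proof -
    have "eventually (\<lambda>\<tau>. dist (w \<tau>) zstar < d) at_top" using wlim d(1) by (rule tendstoD)
    then obtain \<tau>1 where "\<And>\<tau>. \<tau>1 \<le> \<tau> \<Longrightarrow> dist (w \<tau>) zstar < d" by (auto simp: eventually_at_top_linorder)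
    then show thesis using that[of "max 0 \<tau>1"] by simp
  qed
  have Lr: "?L (w \<tau>) < r" if "\<tau>0 \<le> \<tau>" for \<tau> using d(2) \<tau>0(2) that by blast
  have bdd: "?\<theta> w \<tau> \<le> ?\<theta> w \<tau>0 + integrated_time_bound k c1 c r" if \<tau>: "0 \<le> \<tau>" for \<tau>
  proof -
    \<comment> \<open>The decay estimate starts at \<open>\<tau>0\<close>; earlier times are covered
      by monotonicity of physical time.\<close>
    have "?\<theta> w (max \<tau> \<tau>0) \<le> ?\<theta> w \<tau>0 + integrated_time_bound k c1 c r"
    proof (rule physical_time_le_integrated_time_bound[OF k rc(3,4) \<tau>0(1) _ w_cont])
      fix t assume t: "t \<in> {\<tau>0..max \<tau> \<tau>0}"
      show "((\<lambda>t. ?L (w t)) has_real_derivative 2 * ((w t - zstar) \<bullet> (Y *v ?g (w t)))) (at t within {\<tau>0..max \<tau> \<tau>0})"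
        using wder[OF \<tau>0(1) t] .
      show "2 * ((w t - zstar) \<bullet> (Y *v ?g (w t))) \<le> - c * c1 * ?L (w t)"
        using w Lr[of t] t \<tau>0(1) by (intro rc(6)) (auto simp: sublevel_def solves_def)
      show "(w t $ i)\<^sup>2 \<le> c1 * ?L (w t)" using order_trans[OF wsq rc(5)] .
      show "0 \<le> w t $ i" using wpos[of t] t \<tau>0(1) by simp
    qed (use Lr[of \<tau>0] in auto)
    then show ?thesis using \<theta>_mono[of \<tau> "max \<tau> \<tau>0"] \<tau> by simp
  qed
  have lim0: "((\<lambda>\<tau>. w \<tau> $ i) \<longlongrightarrow> 0) at_top"
    using tendsto_vec_nth[OF wlim, of i] p(1) by simp
  have w0: "compactification_inv \<alpha> i \<sigma> (w 0) = y0" using Tz0(1) wz z(1) by simp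
  obtain y tmax where y: "blow_up_solution f y0 y tmax"
    "\<And>\<tau>. 0 \<le> \<tau> \<Longrightarrow> ?\<theta> w \<tau> < tmax \<and> y (?\<theta> w \<tau>) = compactification_inv \<alpha> i \<sigma> (w \<tau>)"
    "(?\<theta> w \<longlongrightarrow> tmax) at_top"
    using blow_up_of_desingularized_solution[OF weights sign f(1) w wpos lim0 bdd] unfolding w0 by blast
  have \<theta>N: "?\<theta> w \<tau>N = ?\<theta> z \<tau>N"
    unfolding physical_time_def by (rule integral_cong) (use wz in auto)
  have bounds: "tmax \<in> {?\<theta> z \<tau>N .. ?\<theta> z \<tau>N + integrated_time_bound k c1 c \<epsilon>}"
    if lc: "lyapunov_constants ?g Nt Y zstar c1 c" for c1 c
  proof -
    have c: "0 < c1" "0 < c" "\<And>z. z \<in> Nt \<Longrightarrow> (norm (z - zstar))\<^sup>2 \<le> c1 * ?L z"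
      "\<And>a b z \<tau>. a < b \<Longrightarrow> solves ?g Nt {a..b} z \<Longrightarrow> \<tau> \<in> {a..b} \<Longrightarrow>
        vector_derivative (\<lambda>t. ?L (z t)) (at \<tau> within {a..b}) \<le> - c * c1 * ?L (z \<tau>)"
      using lc unfolding lyapunov_constants_def by blast+
    \<comment> \<open>After \<open>\<tau>N\<close> the trajectory lies in the sublevel set inside
      \<open>Nt\<close>, where the given constants apply. The strict inequality provides the
      nondegenerate interval that \<open>lyapunov_constants\<close> speaks of.\<close>
    have "?\<theta> w \<tau> \<le> ?\<theta> w \<tau>N + integrated_time_bound k c1 c \<epsilon>" if \<tau>: "\<tau>N < \<tau>" for \<tau>
    proof (rule physical_time_le_integrated_time_bound[OF k c(1,2) _ _ w_cont])
      fix t assume t: "t \<in> {\<tau>N..\<tau>}"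
      have t0: "0 \<le> \<tau>N" using z(1) by simp
      show d: "((\<lambda>t. ?L (w t)) has_real_derivative 2 * ((w t - zstar) \<bullet> (Y *v ?g (w t)))) (at t within {\<tau>N..\<tau>})"
        using wder[OF t0 t] .
      have "solves ?g ?H {\<tau>N..\<tau>} w" by (rule solves_subset[OF w]) (use t0 in auto)
      then have "solves ?g Nt {\<tau>N..\<tau>} w" using wN eps(2) by (auto simp: solves_def)
      from c(4)[OF \<tau> this t]
      show "2 * ((w t - zstar) \<bullet> (Y *v ?g (w t))) \<le> - c * c1 * ?L (w t)"
        using vector_derivative_within_closed_interval[OF \<tau> t d[unfolded has_real_derivative_iff_has_vector_derivative]]
        by simp
      show "(w t $ i)\<^sup>2 \<le> c1 * ?L (w t)" using order_trans[OF wsq c(3)] wN[of t] eps(2) t by auto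
      show "0 \<le> w t $ i" using wpos[of t] t t0 by simp
    qed (use z wz \<tau> in auto)
    then have "eventually (\<lambda>\<tau>. ?\<theta> w \<tau> \<le> ?\<theta> w \<tau>N + integrated_time_bound k c1 c \<epsilon>) at_top"
      using eventually_gt_at_top[of \<tau>N] by (rule eventually_mono[rotated])
    \<comment> \<open>The bound is uniform in \<open>\<tau>\<close>, so it passes to the limit
      \<open>tmax\<close> of physical time.\<close>
    then have "tmax \<le> ?\<theta> w \<tau>N + integrated_time_bound k c1 c \<epsilon>"
      by (rule tendsto_upperbound[OF y(3)]) simp
    then show ?thesis using y(2)[of \<tau>N] z(1) \<theta>N by simp
  qed
  have bounds': "tmax \<in> {?\<theta> z \<tau>N .. ?\<theta> z \<tau>N + blow_up_time_bound k c1 c \<epsilon>}"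
    if "lyapunov_constants ?g Nt Y zstar c1 c" "c1 ^ (k - 1) \<le> (real k)\<^sup>2" for c1 c
    using bounds[OF that(1)] integrated_time_bound_le_blow_up_time_bound[OF k _ _ eps(1) that(2), of c] that(1)
    by (auto simp: lyapunov_constants_def)
  show ?thesis
    using asymptotic_stability w wz wpos wlim y bounds bounds'
    by (intro conjI exI[of _ w] exI[of _ y] exI[of _ tmax]) auto
qed

end
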